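(* Let $W$ be a Coxeter group of type $E_6$ or $E_7$ with Vogan representation $\phi$. Then $\phi$ is faithful if $W$ is of type $E_6$, and $|\mathrm{Ker}\,\phi|=2$ if $W$ is of type $E_7$. Moreover, $\mathrm{Ker}\,\phi=Z(W)$ if $W$ is of type $E_6$ or $E_7$, where $Z(W)$ is the center of $W$.
   Context: For $n\ge 6$ the Coxeter graph of type $E_n$ has vertex set $S=\{s_1,\dots,s_n\}$ and edge set $R=\{s_is_{i+1}: 1\le i\le n-2\}\cup\{s_{n-3}s_n\}$. The Coxeter group $W$ of type $E_n$ is generated by $S$ with relations $s^2=1$, $(ss')^3=1$ if $ss'\in R$, and $(ss')^2=1$ if $s\ne s'$, $ss'\notin R$. $F_2^n$ is the space of column vectors over the two-element field $F_2$ indexed by $S$, and $\widetilde{s}$ is the characteristic vector of $s\in S$. For $s\in S$, $\mathbf{s}$ is the $n\times n$ matrix over $F_2$ acting by $\mathbf{s}\widetilde{v}=\widetilde{v}$ for $v\ne s$ and $\mathbf{s}\widetilde{s}=\widetilde{s}+\sum_{us\in R}\widetilde{u}$. The Vogan representation of $W$ is the homomorphism $\phi:W\to\mathrm{GL}_n(F_2)$ with $\phi(s)=\mathbf{s}$ for $s\in S$. Faithful means injective. *)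

theory Defs
  imports "HOL-Algebra.Coset" "HOL-Library.Z2" "Jordan_Normal_Form.Matrix"
begin

section \<open>Groups given by generators and relations\<close>

text \<open>A word over the generators; the letter \<open>(s, True)\<close> stands for \<open>s\<close> and
  \<open>(s, False)\<close> for the inverse of \<open>s\<close>.\<close>

type_synonym 'a gword = "('a \<times> bool) list"

definition gwords :: "'a set \<Rightarrow> 'a gword set" where
  "gwords S = lists (S \<times> UNIV)"

text \<open>The congruence on words generated by free cancellation and the relations \<open>r = 1\<close> for
  \<open>r \<in> R\<close>.\<close>

inductive pres_eq :: "'a set \<Rightarrow> 'a gword set \<Rightarrow> 'a gword \<Rightarrow> 'a gword \<Rightarrow> bool"
  for S :: "'a set" and R :: "'a gword set"
where
  refl: "u \<in> gwords S \<Longrightarrow> pres_eq S R u u"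
| sym: "pres_eq S R u v \<Longrightarrow> pres_eq S R v u"
| trans: "pres_eq S R u v \<Longrightarrow> pres_eq S R v w \<Longrightarrow> pres_eq S R u w"
| cancel: "u \<in> gwords S \<Longrightarrow> v \<in> gwords S \<Longrightarrow> s \<in> S \<Longrightarrow>
    pres_eq S R (u @ [(s, b), (s, \<not> b)] @ v) (u @ v)"
| relator: "u \<in> gwords S \<Longrightarrow> v \<in> gwords S \<Longrightarrow>
    r \<in> R \<Longrightarrow> r \<in> gwords S \<Longrightarrow> pres_eq S R (u @ r @ v) (u @ v)"

definition pres_rel :: "'a set \<Rightarrow> 'a gword set \<Rightarrow> ('a gword \<times> 'a gword) set" where
  "pres_rel S R = {(u, v). pres_eq S R u v}"

definition presented_group :: "'a set \<Rightarrow> 'a gword set \<Rightarrow> 'a gword set monoid" where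
  "presented_group S R =
    \<lparr> carrier = gwords S // pres_rel S R,
      monoid.mult = (\<lambda>A B. \<Union>u\<in>A. \<Union>v\<in>B. pres_rel S R `` {u @ v}),
      one = pres_rel S R `` {[]} \<rparr>"

definition pres_gen :: "'a set \<Rightarrow> 'a gword set \<Rightarrow> 'a \<Rightarrow> 'a gword set" where
  "pres_gen S R s = pres_rel S R `` {[(s, True)]}"

definition group_center :: "('a, 'b) monoid_scheme \<Rightarrow> 'a set" where
  "group_center G =
    {z \<in> carrier G. \<forall>x\<in>carrier G. z \<otimes>\<^bsub>G\<^esub> x = x \<otimes>\<^bsub>G\<^esub> z}"


section \<open>The Coxeter group of type \<open>E\<^sub>n\<close>\<close>

text \<open>The vertex \<open>s\<^sub>i\<close> of the Coxeter graph is represented by the number \<open>i\<close>. The definitions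
  are meant for \<open>n \<ge> 6\<close>.\<close>

definition E_vertices :: "nat \<Rightarrow> nat set" where
  "E_vertices n = {1..n}"

definition E_edges :: "nat \<Rightarrow> nat set set" where
  "E_edges n = {{i, i + 1} | i. 1 \<le> i \<and> i \<le> n - 2} \<union> {{n - 3, n}}"

definition word_power :: "'a list \<Rightarrow> nat \<Rightarrow> 'a gword" where
  "word_power ss k = concat (replicate k (map (\<lambda>s. (s, True)) ss))"

definition E_relators :: "nat \<Rightarrow> nat gword set" where
  "E_relators n =
    {word_power [s] 2 | s. s \<in> E_vertices n}
    \<union> {word_power [s, t] 3 | s t.
         s \<in> E_vertices n \<and> t \<in> E_vertices n \<and> {s, t} \<in> E_edges n}
    \<union> {word_power [s, t] 2 | s t.
         s \<in> E_vertices n \<and> t \<in> E_vertices n \<and> s \<noteq> t \<and> {s, t} \<notin> E_edges n}"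

definition coxeter_group_E :: "nat \<Rightarrow> nat gword set monoid" where
  "coxeter_group_E n = presented_group (E_vertices n) (E_relators n)"

definition E_gen :: "nat \<Rightarrow> nat \<Rightarrow> nat gword set" where
  "E_gen n s = pres_gen (E_vertices n) (E_relators n) s"


section \<open>The Vogan representation\<close>

text \<open>Coordinates of vectors are numbered from \<open>0\<close>, so the vertex \<open>s\<close> is the coordinate
  \<open>s - 1\<close>.\<close>

definition char_vec :: "nat \<Rightarrow> nat \<Rightarrow> bit vec" where
  "char_vec n s = unit_vec n (s - 1)"

text \<open>The columns of the matrix are the images of the characteristic vectors.\<close>

definition vogan_mat :: "nat \<Rightarrow> nat \<Rightarrow> bit mat" where
  "vogan_mat n s = mat_of_cols n
    (map (\<lambda>v. if v = s
              then char_vec n s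
                     + finsum_vec TYPE(bit) n (char_vec n) {u \<in> E_vertices n. {u, s} \<in> E_edges n}
              else char_vec n v)
      [1..<Suc n])"

definition GL_F2 :: "nat \<Rightarrow> bit mat monoid" where
  "GL_F2 n = units_of (ring_mat TYPE(bit) n ())"

text \<open>As a function on the whole type of sets of words, a representation is only determined on
  the carrier of the group; see \<open>vogan_representation_exists\<close> and
  \<open>vogan_representation_unique\<close> below.\<close>

definition vogan_representation :: "nat \<Rightarrow> (nat gword set \<Rightarrow> bit mat) \<Rightarrow> bool" where
  "vogan_representation n \<phi> \<longleftrightarrow>
    \<phi> \<in> hom (coxeter_group_E n) (GL_F2 n)
    \<and> (\<forall>s\<in>E_vertices n. \<phi> (E_gen n s) = vogan_mat n s)"


section \<open>Basic properties of presented groups\<close>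

lemma gwords_simps [simp]:
  "[] \<in> gwords S"
  "(s, b) # w \<in> gwords S \<longleftrightarrow> s \<in> S \<and> w \<in> gwords S"
  "u @ v \<in> gwords S \<longleftrightarrow> u \<in> gwords S \<and> v \<in> gwords S"
  by (auto simp: gwords_def)

lemma pres_eq_lists:
  assumes "pres_eq S R u v"
  shows "u \<in> gwords S \<and> v \<in> gwords S"
  using assms by induction auto

lemma equiv_pres_rel: "equiv (gwords S) (pres_rel S R)"
proof (rule equivI)
  show "pres_rel S R \<subseteq> gwords S \<times> gwords S"
    using pres_eq_lists by (fastforce simp: pres_rel_def)
  show "refl_on (gwords S) (pres_rel S R)"
    by (rule refl_onI) (auto simp: pres_rel_def intro: pres_eq.refl)
  show "sym_on UNIV (pres_rel S R)"
    by (rule symI) (auto simp: pres_rel_def intro: pres_eq.sym)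
  show "trans_on UNIV (pres_rel S R)"
    by (rule transI) (auto simp: pres_rel_def intro: pres_eq.trans)
qed

lemma pres_eq_context:
  assumes "pres_eq S R u v" and x: "x \<in> gwords S" and y: "y \<in> gwords S"
  shows "pres_eq S R (x @ u @ y) (x @ v @ y)"
  using assms(1)
proof induction
  case (refl u)
  then show ?case using x y by (intro pres_eq.refl) auto
next
  case (sym u v)
  then show ?case by (blast intro: pres_eq.sym)
next
  case (trans u v w)
  then show ?case by (blast intro: pres_eq.trans)
next
  case (cancel u v s b)
  then show ?case using x y pres_eq.cancel[of "x @ u" S "v @ y" s R b] by simp
next
  case (relator u v r)
  then show ?case using x y pres_eq.relator[of "x @ u" S "v @ y" r R] by simp
qed

lemma pres_eq_append:
  assumes "pres_eq S R u u'" and "pres_eq S R v v'"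
  shows "pres_eq S R (u @ v) (u' @ v')"
proof -
  note [simp] = assms[THEN pres_eq_lists]
  have "pres_eq S R ([] @ u @ v) ([] @ u' @ v)"
    using assms by (intro pres_eq_context) auto
  moreover have "pres_eq S R (u' @ v @ []) (u' @ v' @ [])"
    using assms by (intro pres_eq_context) auto
  ultimately show ?thesis using pres_eq.trans by fastforce
qed

abbreviation pres_class :: "'a set \<Rightarrow> 'a gword set \<Rightarrow> 'a gword \<Rightarrow> 'a gword set" where
  "pres_class S R w \<equiv> pres_rel S R `` {w}"

lemma pres_class_eq_iff:
  assumes "u \<in> gwords S" "v \<in> gwords S"
  shows "pres_class S R u = pres_class S R v \<longleftrightarrow> pres_eq S R u v"
  using eq_equiv_class_iff[OF equiv_pres_rel assms, of R] by (simp add: pres_rel_def)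

lemma presented_group_mult:
  assumes u: "u \<in> gwords S" and v: "v \<in> gwords S"
  shows "pres_class S R u \<otimes>\<^bsub>presented_group S R\<^esub> pres_class S R v = pres_class S R (u @ v)"
proof -
  have "pres_class S R (u' @ v') = pres_class S R (u @ v)"
    if "u' \<in> pres_class S R u" "v' \<in> pres_class S R v" for u' v'
  proof -
    have "pres_eq S R u u'" "pres_eq S R v v'" using that by (auto simp: pres_rel_def)
    then have "pres_eq S R (u @ v) (u' @ v')" by (rule pres_eq_append)
    then show ?thesis using pres_class_eq_iff pres_eq_lists pres_eq.sym by metis
  qed
  moreover have "u \<in> pres_class S R u" "v \<in> pres_class S R v"
    using u v by (auto simp: pres_rel_def intro: pres_eq.refl)
  ultimately have "(\<Union>u'\<in>pres_class S R u. \<Union>v'\<in>pres_class S R v. pres_class S R (u' @ v'))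
      = pres_class S R (u @ v)" (is "?L = ?R")
  proof -
    have "?L = (\<Union>u'\<in>pres_class S R u. \<Union>v'\<in>pres_class S R v. ?R)"
      by (intro SUP_cong HOL.refl) fact
    also have "\<dots> = ?R"
      using \<open>u \<in> pres_class S R u\<close> \<open>v \<in> pres_class S R v\<close> by (metis UN_constant empty_iff)
    finally show ?thesis .
  qed
  then show ?thesis by (simp add: presented_group_def)
qed

lemma presented_group_carrier:
  "carrier (presented_group S R) = pres_class S R ` gwords S"
  by (auto simp: presented_group_def quotient_def)

lemma presented_group_one: "\<one>\<^bsub>presented_group S R\<^esub> = pres_class S R []"
  by (simp add: presented_group_def)

definition word_inv :: "'a gword \<Rightarrow> 'a gword" where
  "word_inv w = rev (map (\<lambda>(s, b). (s, \<not> b)) w)"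

lemma word_inv_lists: "w \<in> gwords S \<Longrightarrow> word_inv w \<in> gwords S"
  by (auto simp: word_inv_def gwords_def)

lemma pres_eq_word_inv:
  assumes "w \<in> gwords S"
  shows "pres_eq S R (word_inv w @ w) []"
  using assms
proof (induction w)
  case Nil
  then show ?case by (auto simp: word_inv_def intro: pres_eq.refl)
next
  case (Cons a w)
  obtain s b where a: "a = (s, b)" by force
  have "pres_eq S R (word_inv w @ [(s, \<not> b), (s, \<not> \<not> b)] @ w) (word_inv w @ w)"
    using Cons word_inv_lists[of w S] by (intro pres_eq.cancel) (auto simp: a)
  then have "pres_eq S R (word_inv (a # w) @ a # w) (word_inv w @ w)"
    by (simp add: a word_inv_def)
  moreover have "pres_eq S R (word_inv w @ w) []" using Cons by (auto simp: a)
  ultimately show ?case by (rule pres_eq.trans)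
qed

lemma group_presented_group: "group (presented_group S R)"
proof (rule groupI)
  let ?G = "presented_group S R"
  show "x \<otimes>\<^bsub>?G\<^esub> y \<in> carrier ?G" if "x \<in> carrier ?G" "y \<in> carrier ?G" for x y
    using that by (fastforce simp: presented_group_carrier presented_group_mult)
  show "\<one>\<^bsub>?G\<^esub> \<in> carrier ?G"
    by (simp add: presented_group_carrier presented_group_one)
  show "x \<otimes>\<^bsub>?G\<^esub> y \<otimes>\<^bsub>?G\<^esub> z = x \<otimes>\<^bsub>?G\<^esub> (y \<otimes>\<^bsub>?G\<^esub> z)"
    if "x \<in> carrier ?G" "y \<in> carrier ?G" "z \<in> carrier ?G" for x y z
    using that by (force simp: presented_group_carrier presented_group_mult)
  show "\<one>\<^bsub>?G\<^esub> \<otimes>\<^bsub>?G\<^esub> x = x" if "x \<in> carrier ?G" for x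
    using that by (force simp: presented_group_carrier presented_group_one presented_group_mult)
  show "\<exists>y\<in>carrier ?G. y \<otimes>\<^bsub>?G\<^esub> x = \<one>\<^bsub>?G\<^esub>" if "x \<in> carrier ?G" for x
  proof -
    obtain w where w: "w \<in> gwords S" "x = pres_class S R w"
      using \<open>x \<in> carrier ?G\<close> by (auto simp: presented_group_carrier)
    have i: "word_inv w \<in> gwords S" using w(1) by (rule word_inv_lists)
    have "pres_class S R (word_inv w) \<otimes>\<^bsub>?G\<^esub> x = pres_class S R (word_inv w @ w)"
      unfolding w(2) using i w(1) by (rule presented_group_mult)
    also have "\<dots> = \<one>\<^bsub>?G\<^esub>"
      unfolding presented_group_one
      using pres_class_eq_iff pres_eq_word_inv[OF w(1)] pres_eq_lists by metis
    finally show ?thesis using i by (auto simp: presented_group_carrier)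
  qed
qed

fun word_value :: "('g, 'b) monoid_scheme \<Rightarrow> ('a \<Rightarrow> 'g) \<Rightarrow> 'a gword \<Rightarrow> 'g" where
  "word_value H f [] = \<one>\<^bsub>H\<^esub>"
| "word_value H f ((s, b) # w) = (if b then f s else inv\<^bsub>H\<^esub> f s) \<otimes>\<^bsub>H\<^esub> word_value H f w"

context
  fixes H :: "('g, 'b) monoid_scheme" and f :: "'a \<Rightarrow> 'g" and S :: "'a set"
  assumes H: "group H" and f: "\<And>s. s \<in> S \<Longrightarrow> f s \<in> carrier H"
begin

interpretation group H by (rule H)

lemma word_value_closed: "w \<in> gwords S \<Longrightarrow> word_value H f w \<in> carrier H"
  by (induction w) (auto simp: f)

lemma word_value_append:
  assumes "u \<in> gwords S" "v \<in> gwords S"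
  shows "word_value H f (u @ v) = word_value H f u \<otimes>\<^bsub>H\<^esub> word_value H f v"
  using assms by (induction u) (auto simp: f word_value_closed m_assoc)

lemma word_value_pres_eq:
  assumes "pres_eq S R u v" and R: "\<And>r. r \<in> R \<Longrightarrow> word_value H f r = \<one>\<^bsub>H\<^esub>"
  shows "word_value H f u = word_value H f v"
  using assms(1)
proof induction
  case (cancel u v s b)
  have "word_value H f [(s, b), (s, \<not> b)] = \<one>\<^bsub>H\<^esub>" using cancel by (auto simp: f)
  moreover have c: "[(s, b), (s, \<not> b)] \<in> gwords S" using cancel by auto
  ultimately have "word_value H f ([(s, b), (s, \<not> b)] @ v) = word_value H f v"
    by (subst word_value_append) (use cancel in \<open>auto simp: word_value_closed\<close>)
  then show ?case using cancel c
    by (subst word_value_append; (subst word_value_append)?) auto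
next
  case (relator u v r)
  then show ?case by (simp add: word_value_append R word_value_closed)
qed auto

theorem presented_group_universal:
  assumes R: "\<And>r. r \<in> R \<Longrightarrow> word_value H f r = \<one>\<^bsub>H\<^esub>"
  shows "\<exists>h\<in>hom (presented_group S R) H. \<forall>s\<in>S. h (pres_gen S R s) = f s"
proof -
  define h where "h A = word_value H f (SOME w. w \<in> A)" for A
  have h: "h (pres_class S R w) = word_value H f w" if "w \<in> gwords S" for w
  proof -
    have "w \<in> pres_class S R w" using that by (auto simp: pres_rel_def intro: pres_eq.refl)
    then have "(SOME v. v \<in> pres_class S R w) \<in> pres_class S R w" by (rule someI)
    then have "pres_eq S R w (SOME v. v \<in> pres_class S R w)" by (simp add: pres_rel_def)
    from word_value_pres_eq[OF this R] show ?thesis by (simp add: h_def)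
  qed
  have "h \<in> hom (presented_group S R) H"
    by (rule homI) (auto simp: presented_group_carrier presented_group_mult h
        word_value_closed word_value_append)
  moreover have "h (pres_gen S R s) = f s" if "s \<in> S" for s
    using that by (simp add: pres_gen_def h f)
  ultimately show ?thesis by blast
qed

end

lemma presented_group_hom_unique:
  assumes H: "group H"
    and g: "g \<in> hom (presented_group S R) H" and h: "h \<in> hom (presented_group S R) H"
    and eq: "\<And>s. s \<in> S \<Longrightarrow> g (pres_gen S R s) = h (pres_gen S R s)"
    and x: "x \<in> carrier (presented_group S R)"
  shows "g x = h x"
proof -
  let ?G = "presented_group S R"
  interpret G: group ?G by (rule group_presented_group)
  interpret g: group_hom ?G H g
    by (simp add: group_hom_def group_hom_axioms_def H g group_presented_group)
  interpret h: group_hom ?G H h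
    by (simp add: group_hom_def group_hom_axioms_def H h group_presented_group)
  have gen: "pres_class S R [(s, b)] =
      (if b then pres_gen S R s else inv\<^bsub>?G\<^esub> pres_gen S R s)"
    and gen_in: "pres_gen S R s \<in> carrier ?G" if "s \<in> S" for s b
  proof -
    show c: "pres_gen S R s \<in> carrier ?G"
      using that by (auto simp: presented_group_carrier pres_gen_def)
    have "pres_eq S R ([] @ [(s, False), (s, \<not> False)] @ []) ([] @ [])"
      using that by (intro pres_eq.cancel) auto
    then have "pres_class S R [(s, False), (s, True)] = pres_class S R []"
      using that by (subst pres_class_eq_iff) auto
    then have "pres_class S R [(s, False)] \<otimes>\<^bsub>?G\<^esub> pres_gen S R s = \<one>\<^bsub>?G\<^esub>"
      using that by (simp add: pres_gen_def presented_group_mult presented_group_one)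
    moreover have "pres_class S R [(s, False)] \<in> carrier ?G"
      using that by (auto simp: presented_group_carrier)
    ultimately have "inv\<^bsub>?G\<^esub> pres_gen S R s = pres_class S R [(s, False)]"
      using c by (intro G.inv_equality)
    then show "pres_class S R [(s, b)] =
      (if b then pres_gen S R s else inv\<^bsub>?G\<^esub> pres_gen S R s)"
      by (simp add: pres_gen_def)
  qed
  have "g (pres_class S R w) = h (pres_class S R w)" if "w \<in> gwords S" for w
    using that
  proof (induction w)
    case Nil
    then show ?case using g.hom_one h.hom_one by (simp add: presented_group_one)
  next
    case (Cons a w)
    obtain s b where a: "a = (s, b)" by force
    have s: "s \<in> S" and w: "w \<in> gwords S" using Cons by (auto simp: a)
    have "pres_class S R (a # w) = pres_class S R [(s, b)] \<otimes>\<^bsub>?G\<^esub> pres_class S R w"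
      using s w by (simp add: presented_group_mult a)
    moreover have "pres_class S R w \<in> carrier ?G" "pres_class S R [(s, b)] \<in> carrier ?G"
      using s w by (auto simp: presented_group_carrier)
    moreover have "g (pres_class S R [(s, b)]) = h (pres_class S R [(s, b)])"
      using s by (auto simp: gen gen_in eq)
    ultimately show ?case using Cons w by simp
  qed
  then show ?thesis using x by (auto simp: presented_group_carrier)
qed


section \<open>Existence and uniqueness of the Vogan representation\<close>

lemma vogan_mat_carrier [simp]: "vogan_mat n s \<in> carrier_mat n n"
  by (rule carrier_matI) (simp_all add: vogan_mat_def del: upt_Suc)

lemma vogan_mat_index:
  assumes i: "i < n" and j: "j < n" and s: "s \<in> E_vertices n"
  shows "vogan_mat n s $$ (i, j) =
    of_bool (i = j) + of_bool (j = s - 1 \<and> {Suc i, s} \<in> E_edges n)"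
proof -
  let ?N = "{u \<in> E_vertices n. {u, s} \<in> E_edges n}"
  let ?f = "finsum_vec TYPE(bit) n (char_vec n) ?N"
  let ?col = "\<lambda>v. if v = s then char_vec n s + ?f else char_vec n v"
  have fin: "finite ?N" by (simp add: E_vertices_def)
  have c: "char_vec n \<in> ?N \<rightarrow> carrier_vec n" by (simp add: char_vec_def)
  have d: "?f \<in> carrier_vec n" using c fin by (intro finsum_vec_closed) auto
  have "?f $ i = (\<Sum>u\<in>?N. char_vec n u $ i)"
    by (rule index_finsum_vec[OF fin i c])
  also have "\<dots> = (\<Sum>u\<in>?N. if u = Suc i then 1 else 0)"
    by (rule sum.cong) (use i in \<open>auto simp: char_vec_def E_vertices_def\<close>)
  also have "\<dots> = of_bool (Suc i \<in> ?N)"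
    using fin by (simp add: sum.delta del: mem_Collect_eq)
  also have "\<dots> = of_bool ({Suc i, s} \<in> E_edges n)"
    using i by (simp add: E_vertices_def)
  finally have f: "?f $ i = of_bool ({Suc i, s} \<in> E_edges n)" .
  have "vogan_mat n s $$ (i, j) = map ?col [1..<Suc n] ! j $ i"
    unfolding vogan_mat_def using i j by (intro mat_of_cols_index) (simp_all del: upt_Suc)
  also have "\<dots> = ?col (Suc j) $ i"
    using j by (simp del: upt_Suc)
  also have "\<dots> = of_bool (i = j) + of_bool (j = s - 1 \<and> {Suc i, s} \<in> E_edges n)"
  proof (cases "Suc j = s")
    case True
    have "?col (Suc j) $ i = char_vec n s $ i + ?f $ i"
      using True i d by (simp add: index_add_vec carrier_vecD)
    then show ?thesis using True i j f by (auto simp: char_vec_def)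
  next
    case False
    then have "j \<noteq> s - 1" using s by (auto simp: E_vertices_def)
    then show ?thesis using False i j by (simp add: char_vec_def)
  qed
  finally show ?thesis .
qed

lemma E_edges_irrefl: "n \<ge> 6 \<Longrightarrow> {s} \<notin> E_edges n"
  by (auto simp: E_edges_def doubleton_eq_iff)

lemma vogan_mat_action:
  assumes s: "s \<in> E_vertices n" and x: "x \<in> carrier_vec n"
  shows "vogan_mat n s *\<^sub>v x =
    vec n (\<lambda>i. x $ i + of_bool ({Suc i, s} \<in> E_edges n) * x $ (s - 1))"
proof (rule eq_vecI)
  let ?e = "\<lambda>i. of_bool ({Suc i, s} \<in> E_edges n) :: bit"
  show "dim_vec (vogan_mat n s *\<^sub>v x) = dim_vec (vec n (\<lambda>i. x $ i + ?e i * x $ (s - 1)))"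
    using carrier_matD(1)[OF vogan_mat_carrier] by simp
  fix i assume "i < dim_vec (vec n (\<lambda>i. x $ i + ?e i * x $ (s - 1)))"
  then have i: "i < n" by simp
  have s': "s - 1 < n" using s by (auto simp: E_vertices_def)
  have "(vogan_mat n s *\<^sub>v x) $ i = (\<Sum>j<n. vogan_mat n s $$ (i, j) * x $ j)"
    using i x carrier_matD[OF vogan_mat_carrier[of n s]]
    by (auto simp: scalar_prod_def atLeast0LessThan)
  also have "\<dots> = (\<Sum>j<n. (if j = i then x $ i else 0) + (if j = s - 1 then ?e i * x $ (s - 1) else 0))"
  proof (rule sum.cong[OF HOL.refl])
    fix j assume "j \<in> {..<n}"
    then have j: "j < n" by simp
    show "vogan_mat n s $$ (i, j) * x $ j =
        (if j = i then x $ i else 0) + (if j = s - 1 then ?e i * x $ (s - 1) else 0)"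
      unfolding vogan_mat_index[OF i j s] distrib_right
      by (rule arg_cong2[where f = "(+)"]) auto
  qed
  also have "\<dots> = (\<Sum>j<n. (if j = i then x $ i else 0)) + (\<Sum>j<n. (if j = s - 1 then ?e i * x $ (s - 1) else 0))"
    by (rule sum.distrib)
  also have "\<dots> = x $ i + ?e i * x $ (s - 1)"
    using i s' by (simp only: sum.delta finite_lessThan lessThan_iff if_True)
  finally show "(vogan_mat n s *\<^sub>v x) $ i = vec n (\<lambda>i. x $ i + ?e i * x $ (s - 1)) $ i"
    using i by simp
qed

lemma vogan_mat_action_index:
  assumes "s \<in> E_vertices n" "x \<in> carrier_vec n" "i < n"
  shows "(vogan_mat n s *\<^sub>v x) $ i = x $ i + of_bool ({Suc i, s} \<in> E_edges n) * x $ (s - 1)"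
  using assms by (simp add: vogan_mat_action)

lemma vogan_mat_mult_vec_carrier [simp]:
  "x \<in> carrier_vec n \<Longrightarrow> vogan_mat n s *\<^sub>v x \<in> carrier_vec n"
  by (rule mult_mat_vec_carrier[OF vogan_mat_carrier])

lemma mat_eq_one_if_fixes_vecs:
  fixes A :: "bit mat"
  assumes A: "A \<in> carrier_mat n n" and fix_vec: "\<And>x. x \<in> carrier_vec n \<Longrightarrow> A *\<^sub>v x = x"
  shows "A = 1\<^sub>m n"
proof (rule eq_matI)
  show "dim_row A = dim_row (1\<^sub>m n)" "dim_col A = dim_col (1\<^sub>m n)" using A by auto
  fix i j assume "i < dim_row (1\<^sub>m n :: bit mat)" "j < dim_col (1\<^sub>m n :: bit mat)"
  then have ij: "i < n" "j < n" by auto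
  have "A $$ (i, j) = (A *\<^sub>v unit_vec n j) $ i" using A ij by simp
  also have "\<dots> = 1\<^sub>m n $$ (i, j)"
    using ij fix_vec[OF unit_vec_carrier, of j] by simp
  finally show "A $$ (i, j) = 1\<^sub>m n $$ (i, j)" .
qed

lemma mult_bit_mat_vec:
  fixes A B :: "bit mat"
  assumes "A \<in> carrier_mat n n" "B \<in> carrier_mat n n" "x \<in> carrier_vec n"
  shows "(A * B) *\<^sub>v x = A *\<^sub>v (B *\<^sub>v x)"
  using assms by (rule assoc_mult_mat_vec)

lemma vogan_mat_square_vec:
  assumes n: "n \<ge> 6" and s: "s \<in> E_vertices n" and x: "x \<in> carrier_vec n"
  shows "vogan_mat n s *\<^sub>v (vogan_mat n s *\<^sub>v x) = x"
proof (rule eq_vecI)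
  show "dim_vec (vogan_mat n s *\<^sub>v (vogan_mat n s *\<^sub>v x)) = dim_vec x"
    using x carrier_matD[OF vogan_mat_carrier[of n s]] by simp
  fix i assume "i < dim_vec x"
  then have i: "i < n" using x by simp
  have ss: "s - 1 < n" "Suc (s - 1) = s" using s by (auto simp: E_vertices_def)
  show "(vogan_mat n s *\<^sub>v (vogan_mat n s *\<^sub>v x)) $ i = x $ i"
    using E_edges_irrefl[OF n, of s] i ss s x
    by (cases "x $ i"; cases "x $ (s - 1)"; cases "{Suc i, s} \<in> E_edges n")
      (simp_all add: vogan_mat_action_index del: Suc_pred Suc_diff_1 One_nat_def)
qed

lemma vogan_mat_braid_vec:
  assumes n: "n \<ge> 6" and s: "s \<in> E_vertices n" and t: "t \<in> E_vertices n"
    and x: "x \<in> carrier_vec n"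
  defines "y \<equiv> (\<lambda>z. vogan_mat n s *\<^sub>v (vogan_mat n t *\<^sub>v z))"
  shows "{s, t} \<in> E_edges n \<Longrightarrow> y (y (y x)) = x"
    and "{s, t} \<notin> E_edges n \<Longrightarrow> y (y x) = x"
proof -
  have ss: "s - 1 < n" "Suc (s - 1) = s" using s by (auto simp: E_vertices_def)
  have tt: "t - 1 < n" "Suc (t - 1) = t" using t by (auto simp: E_vertices_def)
  note irr = E_edges_irrefl[OF n, of s] E_edges_irrefl[OF n, of t]
  have y_carrier: "y z \<in> carrier_vec n" if "z \<in> carrier_vec n" for z
    using that by (simp add: y_def)
  define a where "a i = (of_bool ({Suc i, s} \<in> E_edges n) :: bit)" for i
  define b where "b i = (of_bool ({Suc i, t} \<in> E_edges n) :: bit)" for i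
  have y: "y z $ i = z $ i + b i * z $ (t - 1) + a i * (z $ (s - 1) + b (s - 1) * z $ (t - 1))"
    if "z \<in> carrier_vec n" "i < n" for z i
    using that s t ss by (simp add: y_def vogan_mat_action_index a_def b_def del: One_nat_def)
  have irr_a: "a (s - 1) = 0" and irr_b: "b (t - 1) = 0"
    using irr ss tt by (simp_all add: a_def b_def del: One_nat_def)
  show "y (y (y x)) = x" if edge: "{s, t} \<in> E_edges n"
  proof (rule eq_vecI)
    show "dim_vec (y (y (y x))) = dim_vec x" using y_carrier x by (metis carrier_vecD)
    fix i assume "i < dim_vec x"
    then have i: "i < n" using x by simp
    have ab: "b (s - 1) = 1" "a (t - 1) = 1"
      using edge ss tt by (simp_all add: a_def b_def insert_commute del: One_nat_def)
    show "y (y (y x)) $ i = x $ i"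
      using i x ss(1) tt(1)
      by (cases "a i"; cases "b i"; cases "x $ i"; cases "x $ (s - 1)"; cases "x $ (t - 1)")
        (simp_all add: y y_carrier ab irr_a irr_b del: One_nat_def)
  qed
  show "y (y x) = x" if edge: "{s, t} \<notin> E_edges n"
  proof (rule eq_vecI)
    show "dim_vec (y (y x)) = dim_vec x" using y_carrier x by (metis carrier_vecD)
    fix i assume "i < dim_vec x"
    then have i: "i < n" using x by simp
    have ab: "b (s - 1) = 0" "a (t - 1) = 0"
      using edge ss tt by (simp_all add: a_def b_def insert_commute del: One_nat_def)
    show "y (y x) $ i = x $ i"
      using i x ss(1) tt(1)
      by (cases "a i"; cases "b i"; cases "x $ i"; cases "x $ (s - 1)"; cases "x $ (t - 1)")
        (simp_all add: y y_carrier ab irr_a irr_b del: One_nat_def)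
  qed
qed

lemma group_GL_F2: "group (GL_F2 n)"
  unfolding GL_F2_def by (intro monoid.units_group ring.is_monoid ring_mat)

lemma GL_F2_simps:
  "carrier (GL_F2 n) = {A \<in> carrier_mat n n. \<exists>B\<in>carrier_mat n n. B * A = 1\<^sub>m n \<and> A * B = 1\<^sub>m n}"
  "A \<otimes>\<^bsub>GL_F2 n\<^esub> B = A * B"
  "\<one>\<^bsub>GL_F2 n\<^esub> = 1\<^sub>m n"
  by (auto simp: GL_F2_def units_of_def Units_def ring_mat_simps)

lemma vogan_mat_in_GL:
  assumes "n \<ge> 6" "s \<in> E_vertices n"
  shows "vogan_mat n s \<in> carrier (GL_F2 n)"
proof -
  have "vogan_mat n s * vogan_mat n s = 1\<^sub>m n"
    using assms
    by (intro mat_eq_one_if_fixes_vecs mult_carrier_mat[OF vogan_mat_carrier vogan_mat_carrier])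
      (simp add: mult_bit_mat_vec[of _ n] vogan_mat_square_vec)
  then show ?thesis using vogan_mat_carrier by (auto simp: GL_F2_simps)
qed

lemma vogan_mat_relators:
  assumes n: "n \<ge> 6" and r: "r \<in> E_relators n"
  shows "word_value (GL_F2 n) (vogan_mat n) r = \<one>\<^bsub>GL_F2 n\<^esub>"
proof -
  have mult: "A * B \<in> carrier_mat n n"
    if "A \<in> carrier_mat n n" "B \<in> carrier_mat n n" for A B :: "bit mat"
    using that by (rule mult_carrier_mat)
  note simps = word_power_def GL_F2_simps(2,3) numeral_2_eq_2 numeral_3_eq_3
  from r consider
      (square) s where "r = word_power [s] 2" "s \<in> E_vertices n"
    | (edge) s t where "r = word_power [s, t] 3" "s \<in> E_vertices n" "t \<in> E_vertices n"
        "{s, t} \<in> E_edges n"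
    | (no_edge) s t where "r = word_power [s, t] 2" "s \<in> E_vertices n" "t \<in> E_vertices n"
        "{s, t} \<notin> E_edges n"
    unfolding E_relators_def by blast
  then have "word_value (GL_F2 n) (vogan_mat n) r = 1\<^sub>m n"
  proof cases
    case square
    then show ?thesis
      by (intro mat_eq_one_if_fixes_vecs)
        (simp_all add: simps mult mult_bit_mat_vec[of _ n] vogan_mat_square_vec n)
  next
    case edge
    then show ?thesis
      by (intro mat_eq_one_if_fixes_vecs)
        (simp_all add: simps mult mult_bit_mat_vec[of _ n] vogan_mat_braid_vec(1) n)
  next
    case no_edge
    then show ?thesis
      by (intro mat_eq_one_if_fixes_vecs)
        (simp_all add: simps mult mult_bit_mat_vec[of _ n] vogan_mat_braid_vec(2) n)
  qed
  then show ?thesis by (simp only: GL_F2_simps)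
qed

theorem vogan_representation_exists:
  assumes "n \<ge> 6"
  shows "\<exists>\<phi>. vogan_representation n \<phi>"
proof -
  have "\<exists>h\<in>hom (presented_group (E_vertices n) (E_relators n)) (GL_F2 n).
      \<forall>s\<in>E_vertices n. h (pres_gen (E_vertices n) (E_relators n) s) = vogan_mat n s"
    using assms
    by (intro presented_group_universal group_GL_F2 vogan_mat_in_GL vogan_mat_relators)
  then show ?thesis
    unfolding vogan_representation_def coxeter_group_E_def E_gen_def by blast
qed

theorem vogan_representation_unique:
  assumes "vogan_representation n \<phi>" and "vogan_representation n \<psi>"
    and "x \<in> carrier (coxeter_group_E n)"
  shows "\<phi> x = \<psi> x"
proof (rule presented_group_hom_unique[OF group_GL_F2])
  show "\<phi> \<in> hom (presented_group (E_vertices n) (E_relators n)) (GL_F2 n)"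
    "\<psi> \<in> hom (presented_group (E_vertices n) (E_relators n)) (GL_F2 n)"
    "x \<in> carrier (presented_group (E_vertices n) (E_relators n))"
    using assms by (auto simp: vogan_representation_def coxeter_group_E_def)
  show "\<phi> (pres_gen (E_vertices n) (E_relators n) s) = \<psi> (pres_gen (E_vertices n) (E_relators n) s)"
    if "s \<in> E_vertices n" for s
    using assms that by (simp add: vogan_representation_def E_gen_def)
qed

end

theory Submission
  imports Defs
begin

text \<open>The Vogan representation is dual to the reduction modulo two of the geometric representation
  of \<open>W\<close> on the root lattice, which is faithful by Tits' argument. If \<open>w\<close> acts trivially modulo two
  and \<open>x\<close> is a root, then \<open>w x\<close> and \<open>x\<close> are congruent vectors of minimal norm in a positive definite
  even lattice, so \<open>w x = x\<close> or \<open>w x = - x\<close>; hence \<open>w\<close> acts as \<open>1\<close> or \<open>- 1\<close>. Conversely a central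
  element commutes with every simple reflection, so it maps each simple root to plus or minus
  itself and acts trivially modulo two. Finally \<open>- 1\<close> does not lie in the Weyl group of \<open>E\<^sub>6\<close>, because
  it moves the radical of the form modulo three, and it lies in that of \<open>E\<^sub>7\<close> as a power of a
  Coxeter element.\<close>

section \<open>The geometric representation\<close>

definition neighbours :: "nat \<Rightarrow> nat \<Rightarrow> nat set" where
  "neighbours n s = {u \<in> E_vertices n. {u, s} \<in> E_edges n}"

text \<open>Functions are coordinates in the basis of simple roots \<alpha>_s. With (\<alpha>_s,
  \<alpha>_s) = 2 and pairing -1 along edges, this is x - (x, \<alpha>_s) \<alpha>_s.\<close>

definition simple_reflection :: "nat \<Rightarrow> nat \<Rightarrow> (nat \<Rightarrow> int) \<Rightarrow> nat \<Rightarrow> int" where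
  "simple_reflection n s x = x(s := (\<Sum>u\<in>neighbours n s. x u) - x s)"

definition simple_root :: "nat \<Rightarrow> nat \<Rightarrow> int" where
  "simple_root s = (\<lambda>i. of_bool (i = s))"

text \<open>The sign of a letter is ignored because reflections are involutions; the last letter
  acts first.\<close>

primrec word_act :: "nat \<Rightarrow> nat gword \<Rightarrow> (nat \<Rightarrow> int) \<Rightarrow> nat \<Rightarrow> int" where
  "word_act n [] x = x"
| "word_act n (a # w) x = simple_reflection n (fst a) (word_act n w x)"

lemma finite_neighbours [simp]: "finite (neighbours n s)"
  by (simp add: neighbours_def E_vertices_def)

lemma simple_reflection_apply:
  "simple_reflection n s x i = (if i = s then sum x (neighbours n s) - x s else x i)"
  by (simp add: simple_reflection_def)

text \<open>Evaluates neighbour sums of reflected vectors, so that identities between nested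
  reflections become linear identities in the coordinates.\<close>

lemma sum_simple_reflection:
  assumes "finite A"
  shows "sum (simple_reflection n s x) A =
    sum x A + of_bool (s \<in> A) * (sum x (neighbours n s) - 2 * x s)"
proof (cases "s \<in> A")
  case True
  have "sum (simple_reflection n s x) (A - {s}) = sum x (A - {s})"
    by (rule sum.cong) (auto simp: simple_reflection_apply)
  then show ?thesis using True
    by (simp add: sum.remove[OF assms True] simple_reflection_apply)
next
  case False
  then have "sum (simple_reflection n s x) A = sum x A"
    by (intro sum.cong) (auto simp: simple_reflection_apply)
  then show ?thesis using False by simp
qed

lemma rev_gwords: "w \<in> gwords S \<Longrightarrow> rev w \<in> gwords S"
  by (simp add: gwords_def lists_eq_set)

lemma word_act_append: "word_act n (u @ v) x = word_act n u (word_act n v x)"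
  by (induction u) auto

lemma simple_reflection_add:
  "simple_reflection n s (\<lambda>i. x i + y i) =
    (\<lambda>i. simple_reflection n s x i + simple_reflection n s y i)"
  by (auto simp: simple_reflection_def sum.distrib)

lemma simple_reflection_scale:
  "simple_reflection n s (\<lambda>i. c * x i) = (\<lambda>i. c * simple_reflection n s x i)"
  by (auto simp: simple_reflection_def sum_distrib_left algebra_simps)

lemma word_act_add:
  "word_act n w (\<lambda>i. x i + y i) = (\<lambda>i. word_act n w x i + word_act n w y i)"
  by (induction w) (simp_all add: simple_reflection_add)

lemma word_act_scale: "word_act n w (\<lambda>i. c * x i) = (\<lambda>i. c * word_act n w x i)"
  by (induction w) (simp_all add: simple_reflection_scale)

lemma word_act_zero: "word_act n w (\<lambda>i. 0) = (\<lambda>i. 0)"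
  using word_act_scale[of n w 0] by simp

lemma word_act_outside:
  "w \<in> gwords (E_vertices n) \<Longrightarrow> i \<notin> E_vertices n \<Longrightarrow> word_act n w x i = x i"
  by (induction w) (auto simp: simple_reflection_def)

lemma word_act_sum:
  assumes "finite A"
  shows "word_act n w (\<lambda>i. \<Sum>k\<in>A. c k * f k i) = (\<lambda>i. \<Sum>k\<in>A. c k * word_act n w (f k) i)"
  using assms
proof induction
  case empty
  then show ?case by (simp add: word_act_zero)
next
  case (insert a A)
  then show ?case
    by (simp add: word_act_add[of n w "\<lambda>i. c a * f a i"] word_act_scale)
qed

lemma expand_simple_roots:
  assumes "\<And>i. i \<notin> E_vertices n \<Longrightarrow> x i = 0"
  shows "(\<Sum>k\<in>E_vertices n. x k * simple_root k i) = x i"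
proof -
  have "finite (E_vertices n)" by (simp add: E_vertices_def)
  then show ?thesis
    using assms[of i] by (simp add: simple_root_def of_bool_def if_distrib cong: if_cong)
qed

lemma word_act_expand:
  assumes "\<And>i. i \<notin> E_vertices n \<Longrightarrow> x i = 0"
  shows "word_act n w x = (\<lambda>i. \<Sum>k\<in>E_vertices n. x k * word_act n w (simple_root k) i)"
proof -
  have "finite (E_vertices n)" by (simp add: E_vertices_def)
  then have "word_act n w (\<lambda>i. \<Sum>k\<in>E_vertices n. x k * simple_root k i) =
      (\<lambda>i. \<Sum>k\<in>E_vertices n. x k * word_act n w (simple_root k) i)"
    by (rule word_act_sum)
  then show ?thesis by (simp add: expand_simple_roots assms)
qed

text \<open>Words may contain formal inverses; since the generators are involutions, this is still
  the usual Coxeter length.\<close>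

definition coxeter_length :: "nat \<Rightarrow> nat gword \<Rightarrow> nat" where
  "coxeter_length n w = (LEAST k. \<exists>v. pres_eq (E_vertices n) (E_relators n) w v \<and> length v = k)"

text \<open>Under this pairing with the root lattice modulo two, Vogan matrices and reflections are
  adjoint. The shift \<open>i - 1\<close> comes from numbering vector entries from 0.\<close>

definition mod_two_pairing :: "nat \<Rightarrow> bit vec \<Rightarrow> (nat \<Rightarrow> int) \<Rightarrow> bit" where
  "mod_two_pairing n x z = (\<Sum>i\<in>E_vertices n. x $ (i - 1) * of_int (z i))"

context
  fixes n :: nat
  assumes n: "6 \<le> n"
begin

abbreviation W_eq :: "nat gword \<Rightarrow> nat gword \<Rightarrow> bool" (infix "\<approx>" 50) where
  "u \<approx> v \<equiv> pres_eq (E_vertices n) (E_relators n) u v"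

abbreviation gen :: "nat \<Rightarrow> nat \<times> bool" where
  "gen s \<equiv> (s, True)"

section \<open>The Coxeter relations for reflections\<close>

lemma neighbours_irrefl: "s \<notin> neighbours n s"
  using E_edges_irrefl[OF n] by (simp add: neighbours_def)

lemma simple_reflection_involution: "simple_reflection n s (simple_reflection n s x) = x"
  by (simp add: fun_eq_iff simple_reflection_apply sum_simple_reflection neighbours_irrefl cong del: sum.cong_simp)

lemma simple_reflection_commute:
  assumes "s \<notin> neighbours n t" "t \<notin> neighbours n s" "s \<noteq> t"
  shows "simple_reflection n s (simple_reflection n t x) =
    simple_reflection n t (simple_reflection n s x)"
  using assms by (simp add: fun_eq_iff simple_reflection_apply sum_simple_reflection cong del: sum.cong_simp)

lemma simple_reflection_braid:
  assumes "s \<in> neighbours n t" "t \<in> neighbours n s"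
  shows "simple_reflection n s (simple_reflection n t (simple_reflection n s x)) =
    simple_reflection n t (simple_reflection n s (simple_reflection n t x))"
proof -
  have "s \<noteq> t" using assms neighbours_irrefl by auto
  then show ?thesis using assms
    by (simp add: fun_eq_iff simple_reflection_apply sum_simple_reflection neighbours_irrefl cong del: sum.cong_simp)
qed

text \<open>The geometric representation is well defined on \<open>W\<close>: relators act trivially
  by the involution, braid and commutation identities.\<close>

lemma word_act_cong:
  assumes "u \<approx> v"
  shows "word_act n u = word_act n v"
  using assms
proof induction
  case (cancel u v s b)
  then show ?case by (simp add: fun_eq_iff word_act_append simple_reflection_involution)
next
  case (relator u v r)
  have "word_act n r x = x" for x
  proof -
    note simps = word_power_def numeral_2_eq_2 numeral_3_eq_3 simple_reflection_involution
    from relator(3) consider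
        (square) s where "r = word_power [s] 2" "s \<in> E_vertices n"
      | (edge) s t where "r = word_power [s, t] 3" "s \<in> E_vertices n" "t \<in> E_vertices n"
          "{s, t} \<in> E_edges n"
      | (no_edge) s t where "r = word_power [s, t] 2" "s \<in> E_vertices n" "t \<in> E_vertices n"
          "s \<noteq> t" "{s, t} \<notin> E_edges n"
      unfolding E_relators_def by blast
    then show ?thesis
    proof cases
      case square
      then show ?thesis by (simp add: simps)
    next
      case edge
      then have "s \<in> neighbours n t" "t \<in> neighbours n s"
        by (auto simp: neighbours_def insert_commute)
      then show ?thesis using edge
        by (simp add: simps simple_reflection_braid[of s t])
    next
      case no_edge
      then have "s \<notin> neighbours n t" "t \<notin> neighbours n s"
        by (auto simp: neighbours_def insert_commute)
      then show ?thesis using no_edge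
        by (simp add: simps simple_reflection_commute[of s t])
    qed
  qed
  then show ?case by (simp add: word_act_append fun_eq_iff[where f = "word_act n _"])
qed auto

lemma word_act_rev:
  "word_act n (rev w) (word_act n w x) = x"
  by (induction w) (auto simp: word_act_append simple_reflection_involution)

section \<open>Relations between words in \<open>W\<close>\<close>

lemma W_eq_context:
  "u \<approx> v \<Longrightarrow> x \<in> gwords (E_vertices n) \<Longrightarrow> y \<in> gwords (E_vertices n)
    \<Longrightarrow> x @ u @ y \<approx> x @ v @ y"
  by (rule pres_eq_context)

lemma gen_square: "s \<in> E_vertices n \<Longrightarrow> [gen s, gen s] \<approx> []"
  using pres_eq.relator[of "[]" "E_vertices n" "[]" "word_power [s] 2" "E_relators n"]
  by (auto simp: E_relators_def word_power_def numeral_2_eq_2)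

lemma gen_sign:
  assumes s: "s \<in> E_vertices n"
  shows "[(s, b)] \<approx> [gen s]"
proof (cases b)
  case True
  then show ?thesis using s by (auto intro: pres_eq.refl)
next
  case False
  \<comment> \<open>The word s^-1 s s reduces to s^-1 by the relator and to s by free
    cancellation.\<close>
  have "[(s, False)] @ [gen s, gen s] @ [] \<approx> [(s, False)] @ [] @ []"
    using s by (intro W_eq_context gen_square) auto
  moreover have "[] @ [(s, False), (s, \<not> False)] @ [gen s] \<approx> [] @ [gen s]"
    using s by (intro pres_eq.cancel) auto
  ultimately show ?thesis using False by (auto intro: pres_eq.sym pres_eq.trans)
qed

lemma gen_commute:
  assumes st: "s \<in> E_vertices n" "t \<in> E_vertices n" "s \<noteq> t" "{s, t} \<notin> E_edges n"
  shows "[gen s, gen t] \<approx> [gen t, gen s]"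
proof -
  let ?r = "[gen s, gen t, gen s, gen t]"
  have "?r \<in> E_relators n"
    using st by (auto simp: E_relators_def word_power_def numeral_2_eq_2)
  \<comment> \<open>The relator times t s equals t s; cancelling tt and then ss turns the same
    product into s t.\<close>
  then have "[] @ ?r @ [gen t, gen s] \<approx> [] @ [gen t, gen s]"
    using st by (intro pres_eq.relator) auto
  moreover have "[gen s, gen t, gen s] @ [gen t, gen t] @ [gen s] \<approx> [gen s, gen t, gen s] @ [] @ [gen s]"
    using st by (intro W_eq_context gen_square) auto
  moreover have "[gen s, gen t] @ [gen s, gen s] @ [] \<approx> [gen s, gen t] @ [] @ []"
    using st by (intro W_eq_context gen_square) auto
  ultimately show ?thesis by simp (meson pres_eq.sym pres_eq.trans)
qed

lemma gen_braid:
  assumes st: "s \<in> E_vertices n" "t \<in> E_vertices n" "{s, t} \<in> E_edges n"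
  shows "[gen s, gen t, gen s] \<approx> [gen t, gen s, gen t]"
proof -
  let ?r = "[gen s, gen t, gen s, gen t, gen s, gen t]"
  have "?r \<in> E_relators n"
    using st by (force simp: E_relators_def word_power_def numeral_3_eq_3)
  \<comment> \<open>Likewise with t s t: three squares cancel in turn and leave s t s.\<close>
  then have "[] @ ?r @ [gen t, gen s, gen t] \<approx> [] @ [gen t, gen s, gen t]"
    using st by (intro pres_eq.relator) auto
  moreover have "[gen s, gen t, gen s, gen t, gen s] @ [gen t, gen t] @ [gen s, gen t]
      \<approx> [gen s, gen t, gen s, gen t, gen s] @ [] @ [gen s, gen t]"
    using st by (intro W_eq_context gen_square) auto
  moreover have "[gen s, gen t, gen s, gen t] @ [gen s, gen s] @ [gen t]
      \<approx> [gen s, gen t, gen s, gen t] @ [] @ [gen t]"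
    using st by (intro W_eq_context gen_square) auto
  moreover have "[gen s, gen t, gen s] @ [gen t, gen t] @ [] \<approx> [gen s, gen t, gen s] @ [] @ []"
    using st by (intro W_eq_context gen_square) auto
  ultimately show ?thesis by simp (meson pres_eq.sym pres_eq.trans)
qed

lemma rev_cancel:
  assumes "w \<in> gwords (E_vertices n)"
  shows "rev w @ w \<approx> []"
  using assms
proof (induction w)
  case Nil
  then show ?case by (auto intro: pres_eq.refl)
next
  case (Cons a w)
  obtain s b where a: "a = (s, b)" by force
  have s: "s \<in> E_vertices n" and w: "w \<in> gwords (E_vertices n)" using Cons by (auto simp: a)
  from w have w': "rev w \<in> gwords (E_vertices n)" by (rule rev_gwords)
  have "[(s, b)] @ [(s, b)] \<approx> [gen s] @ [gen s]"
    using gen_sign[OF s] by (intro pres_eq_append)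
  then have "[(s, b), (s, b)] \<approx> []" using gen_square[OF s] by (auto intro: pres_eq.trans)
  then have "rev w @ [(s, b), (s, b)] @ w \<approx> rev w @ [] @ w"
    using w w' by (intro W_eq_context)
  then show ?case using Cons.IH[OF w] by (auto simp: a intro: pres_eq.trans)
qed

section \<open>Faithfulness of the geometric representation\<close>

lemma coxeter_length_le: "w \<approx> v \<Longrightarrow> coxeter_length n w \<le> length v"
  unfolding coxeter_length_def by (rule Least_le) blast

lemma coxeter_length_reduced:
  assumes "w \<in> gwords (E_vertices n)"
  obtains v where "w \<approx> v" "length v = coxeter_length n w"
proof -
  have "\<exists>k v. w \<approx> v \<and> length v = k" using pres_eq.refl[OF assms] by blast
  then have "\<exists>v. w \<approx> v \<and> length v = coxeter_length n w"
    unfolding coxeter_length_def by (rule LeastI_ex)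
  then show ?thesis using that by blast
qed

lemma coxeter_length_cong:
  assumes "u \<approx> v"
  shows "coxeter_length n u = coxeter_length n v"
proof -
  have "u \<approx> w \<longleftrightarrow> v \<approx> w" for w using assms pres_eq.sym pres_eq.trans by metis
  then show ?thesis by (simp add: coxeter_length_def)
qed

lemma coxeter_length_append:
  assumes "u \<in> gwords (E_vertices n)" "v \<in> gwords (E_vertices n)"
  shows "coxeter_length n (u @ v) \<le> coxeter_length n u + length v"
proof -
  obtain u' where u': "u \<approx> u'" "length u' = coxeter_length n u"
    using coxeter_length_reduced[OF assms(1)] .
  have "u @ v \<approx> u' @ v" using u'(1) assms(2) by (intro pres_eq_append pres_eq.refl)
  then show ?thesis using coxeter_length_le[of "u @ v" "u' @ v"] u'(2) by simp
qed

text \<open>Dropping the last letter of a shortest word lowers the length by exactly one: minimality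
  bounds the prefix, subadditivity the whole.\<close>

lemma last_descent:
  assumes w: "w \<in> gwords (E_vertices n)" and "coxeter_length n w \<noteq> 0"
  obtains v t where "v \<in> gwords (E_vertices n)" "t \<in> E_vertices n" "w \<approx> v @ [gen t]"
    "coxeter_length n w = Suc (coxeter_length n v)"
proof -
  obtain w' where w': "w \<approx> w'" "length w' = coxeter_length n w"
    using coxeter_length_reduced[OF w] .
  then obtain v t b where vt: "w' = v @ [(t, b)]"
    using assms(2) by (metis length_0_conv rev_exhaust surj_pair)
  have v: "v \<in> gwords (E_vertices n)" and t: "t \<in> E_vertices n"
    using pres_eq_lists[OF w'(1)] by (auto simp: vt)
  have "w' \<approx> v @ [gen t]"
    unfolding vt using v gen_sign[OF t] by (intro pres_eq_append pres_eq.refl)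
  then have eq: "w \<approx> v @ [gen t]" using w'(1) pres_eq.trans by blast
  have "coxeter_length n w \<le> coxeter_length n v + 1"
    using coxeter_length_append[of v "[gen t]"] coxeter_length_cong[OF eq] v t by simp
  moreover have "coxeter_length n v \<le> length v"
    using v by (intro coxeter_length_le pres_eq.refl)
  ultimately have "coxeter_length n w = Suc (coxeter_length n v)" using w'(2) by (simp add: vt)
  then show ?thesis using that v t eq by blast
qed

section \<open>Positivity of roots\<close>

lemma reflect_simple_root_self:
  "simple_reflection n s (simple_root s) = (\<lambda>i. - simple_root s i)"
proof -
  have "(\<Sum>u\<in>neighbours n s. simple_root s u) = 0"
    using neighbours_irrefl by (intro sum.neutral) (auto simp: simple_root_def)
  then show ?thesis by (auto simp: simple_reflection_def simple_root_def)
qed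

lemma reflect_simple_root_other:
  assumes "s \<noteq> t"
  shows "simple_reflection n t (simple_root s) =
    (\<lambda>i. simple_root s i + of_bool (s \<in> neighbours n t) * simple_root t i)"
proof -
  have "(\<Sum>u\<in>neighbours n t. simple_root s u) = of_bool (s \<in> neighbours n t)"
    by (simp add: simple_root_def of_bool_def)
  then show ?thesis using assms by (auto simp: simple_reflection_def simple_root_def)
qed

lemma word_act_neg: "word_act n w (\<lambda>i. - x i) = (\<lambda>i. - word_act n w x i)"
  using word_act_scale[of n w "-1" x] by simp

text \<open>The rank two step of Tits' argument is made explicit: in a simply laced group it involves
  only the elements \<open>t\<close> and \<open>s t\<close> of the dihedral group generated by \<open>s\<close> and \<open>t\<close>.\<close>

lemma ascent_root_nonneg:
  assumes "w \<in> gwords (E_vertices n)" "s \<in> E_vertices n"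
    and "coxeter_length n w \<le> coxeter_length n (w @ [gen s])"
  shows "0 \<le> word_act n w (simple_root s) i"
  using assms
proof (induction "coxeter_length n w" arbitrary: w s rule: less_induct)
  case less
  note w = less.prems(1) and s = less.prems(2) and asc = less.prems(3)
  show ?case
  proof (cases "coxeter_length n w = 0")
    case True
    then have "w \<approx> []" using coxeter_length_reduced[OF w] by (metis length_0_conv)
    from word_act_cong[OF this] show ?thesis by (simp add: simple_root_def)
  next
    case False
    then obtain v t where v: "v \<in> gwords (E_vertices n)" and t: "t \<in> E_vertices n"
      and wvt: "w \<approx> v @ [gen t]" and len: "coxeter_length n w = Suc (coxeter_length n v)"
      using last_descent[OF w] by metis
    have ws: "w @ [gen s] \<approx> v @ [gen t, gen s]"
      using pres_eq_append[OF wvt pres_eq.refl[of "[gen s]"]] s by simp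
    \<comment> \<open>If s were t, then \<open>w @ [gen s]\<close> would be shorter than
      \<open>w\<close>, against the ascent hypothesis.\<close>
    have "coxeter_length n (v @ [gen t, gen t]) = coxeter_length n v"
      using coxeter_length_cong[OF W_eq_context[OF gen_square[OF t] v, of "[]"]] by simp
    then have st: "s \<noteq> t" using asc len coxeter_length_cong[OF ws] by auto
    have act_w: "word_act n w = word_act n (v @ [gen t])" using word_act_cong[OF wvt] .
    show ?thesis
    proof (cases "{s, t} \<in> E_edges n")
      case False
      \<comment> \<open>Here t fixes \<alpha>_s, and commuting s past t turns the ascent of w into
        l(v) \<le> l(vs).\<close>
      have "v @ [gen t, gen s] @ [] \<approx> v @ [gen s, gen t] @ []"
        using s t v st False by (intro W_eq_context gen_commute) (auto simp: insert_commute)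
      then have "coxeter_length n (w @ [gen s]) = coxeter_length n ((v @ [gen s]) @ [gen t])"
        using coxeter_length_cong[OF ws] coxeter_length_cong by fastforce
      also have "\<dots> \<le> coxeter_length n (v @ [gen s]) + 1"
        using coxeter_length_append[of "v @ [gen s]" "[gen t]"] v s t by simp
      finally have "0 \<le> word_act n v (simple_root s) i"
        using asc len v s by (intro less.hyps) auto
      moreover have "s \<notin> neighbours n t" using False by (simp add: neighbours_def)
      ultimately show ?thesis
        by (simp add: act_w word_act_append reflect_simple_root_other[OF st])
    next
      case edge: True
      then have nb: "s \<in> neighbours n t" "t \<in> neighbours n s"
        using s t by (auto simp: neighbours_def insert_commute)
      show ?thesis
      proof (cases "coxeter_length n v \<le> coxeter_length n (v @ [gen s])")
        case True
        \<comment> \<open>t sends \<alpha>_s to \<alpha>_s + \<alpha>_t, and v has ascents at both s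
          and t.\<close>
        then have "0 \<le> word_act n v (simple_root s) i"
          using len v s by (intro less.hyps) auto
        moreover have "0 \<le> word_act n v (simple_root t) i"
          using len v t coxeter_length_cong[OF wvt] by (intro less.hyps) auto
        ultimately show ?thesis using nb
          by (simp add: act_w word_act_append reflect_simple_root_other[OF st] word_act_add)
      next
        case False
        \<comment> \<open>Now v = us with u shorter, so w = ust and w \<alpha>_s = us(\<alpha>_s +
          \<alpha>_t) = u \<alpha>_t.\<close>
        define u where "u = v @ [gen s]"
        have u: "u \<in> gwords (E_vertices n)" using v s by (simp add: u_def)
        have "v @ [gen s, gen s] @ [] \<approx> v @ [] @ []"
          using v s by (intro W_eq_context gen_square) auto
        then have vu: "v \<approx> u @ [gen s]" by (auto simp: u_def intro: pres_eq.sym)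
        have len_u: "Suc (coxeter_length n u) \<le> coxeter_length n v"
          using False by (simp add: u_def)
        have ws': "w @ [gen s] \<approx> (u @ [gen t]) @ [gen s, gen t]"
        proof -
          have "v @ [gen t, gen s] \<approx> (u @ [gen s]) @ [gen t, gen s]"
            using vu s t by (intro pres_eq_append pres_eq.refl) auto
          moreover have "u @ [gen s, gen t, gen s] @ [] \<approx> u @ [gen t, gen s, gen t] @ []"
            using u s t edge by (intro W_eq_context gen_braid) auto
          ultimately show ?thesis using ws by simp (meson pres_eq.trans)
        qed
        \<comment> \<open>Since ws = utst, l(ut) \<ge> l(ws) - 2 \<ge> l(w) - 2 \<ge> l(u), an
          ascent of u at t.\<close>
        have "coxeter_length n (w @ [gen s]) \<le> coxeter_length n (u @ [gen t]) + 2"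
          unfolding coxeter_length_cong[OF ws']
          using coxeter_length_append[of "u @ [gen t]" "[gen s, gen t]"] u s t by simp
        then have "0 \<le> word_act n u (simple_root t) i"
          using len len_u asc u t by (intro less.hyps) auto
        moreover have "word_act n w (simple_root s) = word_act n u (simple_root t)"
          using nb st reflect_simple_root_self[of s] reflect_simple_root_other[of t s]
          by (simp add: act_w word_act_append word_act_cong[OF vu] reflect_simple_root_other
              simple_reflection_add)
        ultimately show ?thesis by simp
      qed
    qed
  qed
qed

text \<open>A nontrivial w can be written vt with v shorter, and v \<alpha>_t is then nonnegative.
  Hence w \<alpha>_t = -v \<alpha>_t cannot be \<alpha>_t.\<close>

theorem geometric_representation_faithful:
  assumes w: "w \<in> gwords (E_vertices n)"
    and fix_roots: "\<And>s. s \<in> E_vertices n \<Longrightarrow> word_act n w (simple_root s) = simple_root s"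
  shows "w \<approx> []"
proof (rule ccontr)
  assume "\<not> w \<approx> []"
  then have "coxeter_length n w \<noteq> 0"
    using coxeter_length_reduced[OF w] by (metis length_0_conv)
  then obtain v t where v: "v \<in> gwords (E_vertices n)" and t: "t \<in> E_vertices n"
    and wvt: "w \<approx> v @ [gen t]" and len: "coxeter_length n w = Suc (coxeter_length n v)"
    using last_descent[OF w] by metis
  have "0 \<le> word_act n v (simple_root t) t"
    using v t len coxeter_length_cong[OF wvt] by (intro ascent_root_nonneg) auto
  moreover have "simple_root t t = - word_act n v (simple_root t) t"
    using fun_cong[OF fix_roots[OF t], of t]
    by (simp add: word_act_cong[OF wvt] word_act_append reflect_simple_root_self word_act_neg)
  ultimately show False by (simp add: simple_root_def)
qed

text \<open>Faithfulness applied to v^-1 u, with v^-1 given by \<open>rev v\<close>.\<close>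

lemma W_eq_if_act_eq:
  assumes u: "u \<in> gwords (E_vertices n)" and v: "v \<in> gwords (E_vertices n)"
    and eq: "\<And>s. s \<in> E_vertices n \<Longrightarrow> word_act n u (simple_root s) = word_act n v (simple_root s)"
  shows "u \<approx> v"
proof -
  have v': "rev v \<in> gwords (E_vertices n)" using v by (rule rev_gwords)
  have "rev v @ u \<approx> []"
    using u v' by (intro geometric_representation_faithful) (auto simp: word_act_append eq word_act_rev)
  then have "v @ (rev v @ u) @ [] \<approx> v @ [] @ []" using v by (intro W_eq_context) auto
  moreover have "[] @ (v @ rev v) @ u \<approx> [] @ [] @ u"
    using u rev_cancel[OF v'] by (intro W_eq_context) auto
  ultimately show ?thesis by simp (meson pres_eq.sym pres_eq.trans)
qed


section \<open>Reduction modulo two\<close>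

lemma of_int_bit_eq_iff: "(of_int a :: bit) = of_int b \<longleftrightarrow> even (a - b)"
proof
  assume "even (a - b)"
  then obtain k where "a = b + 2 * k" by (metis add_diff_cancel_left' diff_add_cancel dvdE add.commute)
  then show "(of_int a :: bit) = of_int b" by simp
next
  assume eq: "(of_int a :: bit) = of_int b"
  show "even (a - b)"
  proof (rule ccontr)
    assume "odd (a - b)"
    then obtain k where "a - b = 2 * k + 1" by (elim oddE)
    then have "a = b + 2 * k + 1" by simp
    then show False using eq by (cases "of_int b :: bit") simp_all
  qed
qed

lemma finite_E_vertices: "finite (E_vertices n)"
  by (simp add: E_vertices_def)

lemma mod_two_pairing_unit_vec:
  assumes "i \<in> E_vertices n"
  shows "mod_two_pairing n (unit_vec n (i - 1)) z = of_int (z i)"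
proof -
  have "mod_two_pairing n (unit_vec n (i - 1)) z =
      (\<Sum>j\<in>E_vertices n. if j = i then of_int (z i) else 0)"
    unfolding mod_two_pairing_def
    by (rule sum.cong) (use assms in \<open>auto simp: E_vertices_def\<close>)
  then show ?thesis using assms finite_E_vertices by simp
qed

lemma mod_two_pairing_simple_root:
  assumes "s \<in> E_vertices n"
  shows "mod_two_pairing n x (simple_root s) = x $ (s - 1)"
proof -
  have "mod_two_pairing n x (simple_root s) = (\<Sum>j\<in>E_vertices n. if j = s then x $ (s - 1) else 0)"
    unfolding mod_two_pairing_def by (rule sum.cong) (auto simp: simple_root_def)
  then show ?thesis using assms finite_E_vertices by simp
qed

lemma mod_two_pairing_cong:
  assumes "\<And>i. i \<in> E_vertices n \<Longrightarrow> even (y i - z i)"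
  shows "mod_two_pairing n x y = mod_two_pairing n x z"
  unfolding mod_two_pairing_def
proof (rule sum.cong)
  fix i assume "i \<in> E_vertices n"
  then have "(of_int (y i) :: bit) = of_int (z i)" by (simp only: of_int_bit_eq_iff assms)
  then show "x $ (i - 1) * of_int (y i) = x $ (i - 1) * of_int (z i)" by simp
qed simp

text \<open>The matrix adds x_s to every entry next to s, so the pairing gains x_s times the
  neighbour sum of z. The reflection adds the same at s, up to a sign that vanishes modulo
  two.\<close>

lemma mod_two_pairing_vogan_mat:
  assumes s: "s \<in> E_vertices n" and x: "x \<in> carrier_vec n"
  shows "mod_two_pairing n (vogan_mat n s *\<^sub>v x) z = mod_two_pairing n x (simple_reflection n s z)"
proof -
  let ?N = "\<Sum>i\<in>neighbours n s. of_int (z i) :: bit"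
  have "mod_two_pairing n (vogan_mat n s *\<^sub>v x) z =
      (\<Sum>i\<in>E_vertices n. x $ (i - 1) * of_int (z i) +
        (if i \<in> neighbours n s then x $ (s - 1) * of_int (z i) else 0))"
    unfolding mod_two_pairing_def
  proof (rule sum.cong)
    fix i assume i: "i \<in> E_vertices n"
    then have "i - 1 < n" "Suc (i - 1) = i" by (auto simp: E_vertices_def)
    then have "(vogan_mat n s *\<^sub>v x) $ (i - 1) =
        x $ (i - 1) + of_bool (i \<in> neighbours n s) * x $ (s - 1)"
      using i by (simp only: vogan_mat_action_index[OF s x] neighbours_def mem_Collect_eq simp_thms)
    then show "(vogan_mat n s *\<^sub>v x) $ (i - 1) * of_int (z i) = x $ (i - 1) * of_int (z i) +
        (if i \<in> neighbours n s then x $ (s - 1) * of_int (z i) else 0)"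
      by (cases "i \<in> neighbours n s")
        (simp_all only: of_bool_eq if_True if_False distrib_right mult_1 mult_zero_left add_0_right)
  qed simp
  also have "\<dots> = mod_two_pairing n x z + x $ (s - 1) * ?N"
  proof -
    have "E_vertices n \<inter> neighbours n s = neighbours n s" by (auto simp: neighbours_def)
    then have "(\<Sum>i\<in>E_vertices n. if i \<in> neighbours n s then x $ (s - 1) * of_int (z i) else 0) =
        x $ (s - 1) * ?N"
      by (simp only: sum.inter_restrict[OF finite_E_vertices, symmetric] sum_distrib_left)
    then show ?thesis by (simp only: sum.distrib mod_two_pairing_def)
  qed
  \<comment> \<open>The extra term is regrouped as a change at the single coordinate s.\<close>
  also have "\<dots> = (\<Sum>i\<in>E_vertices n. x $ (i - 1) * of_int (z i) +
      (if i = s then x $ (s - 1) * ?N else 0))"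
    using s by (simp only: sum.distrib mod_two_pairing_def sum.delta[OF finite_E_vertices] if_True)
  also have "\<dots> = mod_two_pairing n x (simple_reflection n s z)"
    unfolding mod_two_pairing_def
  proof (rule sum.cong)
    fix i assume "i \<in> E_vertices n"
    have "(of_int (sum z (neighbours n s) - z s) :: bit) = of_int (sum z (neighbours n s) + z s)"
      by (simp only: of_int_bit_eq_iff) simp
    then show "x $ (i - 1) * of_int (z i) + (if i = s then x $ (s - 1) * ?N else 0) =
        x $ (i - 1) * of_int (simple_reflection n s z i)"
      by (simp add: simple_reflection_apply distrib_left of_int_sum algebra_simps
          del: One_nat_def of_int_diff)
  qed simp
  finally show ?thesis .
qed

section \<open>Matrices of whole words\<close>

abbreviation W_class :: "nat gword \<Rightarrow> nat gword set" where
  "W_class w \<equiv> pres_class (E_vertices n) (E_relators n) w"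

lemma W_class_eq_iff:
  "u \<in> gwords (E_vertices n) \<Longrightarrow> v \<in> gwords (E_vertices n) \<Longrightarrow> W_class u = W_class v \<longleftrightarrow> u \<approx> v"
  by (rule pres_class_eq_iff)

context
  fixes \<phi> :: "nat gword set \<Rightarrow> bit mat"
  assumes \<phi>: "vogan_representation n \<phi>"
begin

interpretation vogan: group_hom "coxeter_group_E n" "GL_F2 n" \<phi>
  using \<phi> group_GL_F2 group_presented_group
  by (auto simp: group_hom_def group_hom_axioms_def vogan_representation_def coxeter_group_E_def)

lemma vogan_class_carrier:
  assumes "w \<in> gwords (E_vertices n)"
  shows "\<phi> (W_class w) \<in> carrier_mat n n"
proof -
  have "W_class w \<in> carrier (coxeter_group_E n)"
    using assms by (simp add: coxeter_group_E_def presented_group_carrier)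
  then have "\<phi> (W_class w) \<in> carrier (GL_F2 n)" by (rule vogan.hom_closed)
  then show ?thesis by (simp add: GL_F2_simps)
qed

lemma vogan_class_Nil: "\<phi> (W_class []) = 1\<^sub>m n"
  using vogan.hom_one by (simp add: coxeter_group_E_def presented_group_one GL_F2_simps)

text \<open>A letter and its formal inverse have the same matrix, since both represent the
  involution s.\<close>

lemma vogan_class_Cons:
  assumes s: "s \<in> E_vertices n" and w: "w \<in> gwords (E_vertices n)"
  shows "\<phi> (W_class ((s, b) # w)) = vogan_mat n s * \<phi> (W_class w)"
proof -
  have "W_class [(s, b)] = E_gen n s"
    using gen_sign[OF s, of b] s by (simp add: E_gen_def pres_gen_def W_class_eq_iff)
  moreover have "W_class ((s, b) # w) = W_class [(s, b)] \<otimes>\<^bsub>coxeter_group_E n\<^esub> W_class w"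
    using s w by (simp add: coxeter_group_E_def presented_group_mult)
  moreover have "W_class [(s, b)] \<in> carrier (coxeter_group_E n)"
    "W_class w \<in> carrier (coxeter_group_E n)"
    using s w by (simp_all add: coxeter_group_E_def presented_group_carrier)
  ultimately show ?thesis
    using vogan.hom_mult \<phi> s by (simp add: GL_F2_simps vogan_representation_def)
qed

text \<open>Taking adjoints reverses products, hence \<open>rev w\<close> on the lattice
  side.\<close>

lemma mod_two_pairing_vogan:
  assumes "w \<in> gwords (E_vertices n)" "x \<in> carrier_vec n"
  shows "mod_two_pairing n (\<phi> (W_class w) *\<^sub>v x) z = mod_two_pairing n x (word_act n (rev w) z)"
  using assms
proof (induction w arbitrary: z)
  case Nil
  then show ?case by (simp add: vogan_class_Nil)
next
  case (Cons a w)
  obtain s b where a: "a = (s, b)" by force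
  have s: "s \<in> E_vertices n" and w: "w \<in> gwords (E_vertices n)" using Cons by (auto simp: a)
  let ?M = "\<phi> (W_class w)"
  have M: "?M \<in> carrier_mat n n" using w by (rule vogan_class_carrier)
  have "\<phi> (W_class (a # w)) *\<^sub>v x = vogan_mat n s *\<^sub>v (?M *\<^sub>v x)"
    unfolding a vogan_class_Cons[OF s w]
    using M Cons.prems by (intro mult_bit_mat_vec) auto
  moreover have "?M *\<^sub>v x \<in> carrier_vec n" using M Cons.prems by simp
  ultimately show ?case
    using Cons w by (simp add: mod_two_pairing_vogan_mat[OF s] word_act_append a)
qed

text \<open>The pairing is perfect: unit vectors read off lattice coordinates modulo two, which
  gives one direction, and simple roots read off vector entries, which gives the other.\<close>

lemma vogan_class_eq_one_iff:
  assumes w: "w \<in> gwords (E_vertices n)"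
  shows "\<phi> (W_class w) = 1\<^sub>m n \<longleftrightarrow> (\<forall>s\<in>E_vertices n. \<forall>i\<in>E_vertices n.
    even (word_act n (rev w) (simple_root s) i - simple_root s i))"
proof (intro iffI ballI)
  fix s i assume one: "\<phi> (W_class w) = 1\<^sub>m n" and "s \<in> E_vertices n" and i: "i \<in> E_vertices n"
  have "(of_int (word_act n (rev w) (simple_root s) i) :: bit) = of_int (simple_root s i)"
    using mod_two_pairing_vogan[OF w, of "unit_vec n (i - 1)" "simple_root s"]
    by (simp add: one mod_two_pairing_unit_vec[OF i] del: One_nat_def)
  then show "even (word_act n (rev w) (simple_root s) i - simple_root s i)"
    by (simp only: of_int_bit_eq_iff)
next
  assume even: "\<forall>s\<in>E_vertices n. \<forall>i\<in>E_vertices n.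
    even (word_act n (rev w) (simple_root s) i - simple_root s i)"
  let ?M = "\<phi> (W_class w)"
  have M: "?M \<in> carrier_mat n n" using w by (rule vogan_class_carrier)
  show "?M = 1\<^sub>m n"
  proof (rule mat_eq_one_if_fixes_vecs[OF M])
    fix x :: "bit vec" assume x: "x \<in> carrier_vec n"
    show "?M *\<^sub>v x = x"
    proof (rule eq_vecI)
      show "dim_vec (?M *\<^sub>v x) = dim_vec x" using M x by simp
      fix i assume "i < dim_vec x"
      then have i: "Suc i \<in> E_vertices n" using x by (simp add: E_vertices_def)
      have "mod_two_pairing n (?M *\<^sub>v x) (simple_root (Suc i)) = mod_two_pairing n x (simple_root (Suc i))"
        unfolding mod_two_pairing_vogan[OF w x] using even i by (intro mod_two_pairing_cong) auto
      then show "(?M *\<^sub>v x) $ i = x $ i" by (simp add: mod_two_pairing_simple_root[OF i])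
    qed
  qed
qed

end

end

section \<open>The quadratic form of the root lattice\<close>

text \<open>This is (x, x) / 2 in simple root coordinates, so simple roots have value 1. The
  products run over the edges.\<close>

definition root_form :: "nat \<Rightarrow> (nat \<Rightarrow> int) \<Rightarrow> int" where
  "root_form n x = (\<Sum>i\<in>{1..n}. x i ^ 2) - (\<Sum>i\<in>{1..n-2}. x i * x (i + 1)) - x (n - 3) * x n"

text \<open>The parallelogram law for the vectors x + y and y.\<close>

lemma root_form_parallelogram:
  "root_form n (\<lambda>i. x i + 2 * y i) + root_form n x = 2 * root_form n (\<lambda>i. x i + y i) + 2 * root_form n y"
  by (simp add: root_form_def power2_eq_square algebra_simps sum.distrib sum_distrib_left)

text \<open>Tested on simple roots only: a word over the vertices leaves all other coordinates
  unchanged, so it cannot act as -1 on arbitrary functions.\<close>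

definition acts_as_scalar :: "nat \<Rightarrow> nat gword \<Rightarrow> int \<Rightarrow> bool" where
  "acts_as_scalar n w c \<longleftrightarrow>
    (\<forall>s\<in>E_vertices n. word_act n w (simple_root s) = (\<lambda>i. c * simple_root s i))"

section \<open>Explicit diagrams and forms of types \<open>E\<^sub>6\<close> and
  \<open>E\<^sub>7\<close>\<close>

lemma E_edges_iff:
  "{u, s} \<in> E_edges n \<longleftrightarrow> (s = u + 1 \<and> 1 \<le> u \<and> u \<le> n - 2) \<or> (u = s + 1 \<and> 1 \<le> s \<and> s \<le> n - 2)
    \<or> (u = n - 3 \<and> s = n) \<or> (u = n \<and> s = n - 3)"
  by (auto simp: E_edges_def doubleton_eq_iff)

lemma simple_root_apply: "simple_root s i = of_bool (i = s)"
  by (simp add: simple_root_def)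

lemma E_vertices_6: "E_vertices 6 = {1, 2, 3, 4, 5, 6}"
  by (auto simp: E_vertices_def)

lemma E_vertices_7: "E_vertices 7 = {1, 2, 3, 4, 5, 6, 7}"
  by (auto simp: E_vertices_def)

lemma neighbours_6:
  "neighbours 6 1 = {2}" "neighbours 6 2 = {1, 3}" "neighbours 6 3 = {2, 4, 6}"
  "neighbours 6 4 = {3, 5}" "neighbours 6 5 = {4}" "neighbours 6 6 = {3}"
  by (auto simp: neighbours_def E_vertices_def E_edges_iff)

lemma neighbours_7:
  "neighbours 7 1 = {2}" "neighbours 7 2 = {1, 3}" "neighbours 7 3 = {2, 4}"
  "neighbours 7 4 = {3, 5, 7}" "neighbours 7 5 = {4, 6}" "neighbours 7 6 = {5}"
  "neighbours 7 7 = {4}"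
  by (auto simp: neighbours_def E_vertices_def E_edges_iff)

lemma root_form_6:
  "root_form 6 x = x 1 ^ 2 + x 2 ^ 2 + x 3 ^ 2 + x 4 ^ 2 + x 5 ^ 2 + x 6 ^ 2
    - x 1 * x 2 - x 2 * x 3 - x 3 * x 4 - x 4 * x 5 - x 3 * x 6"
proof -
  have "{1..6::nat} = {1, 2, 3, 4, 5, 6}" "{1..6 - 2::nat} = {1, 2, 3, 4}" by auto
  then show ?thesis by (simp add: root_form_def del: One_nat_def)
qed

lemma root_form_7:
  "root_form 7 x = x 1 ^ 2 + x 2 ^ 2 + x 3 ^ 2 + x 4 ^ 2 + x 5 ^ 2 + x 6 ^ 2 + x 7 ^ 2
    - x 1 * x 2 - x 2 * x 3 - x 3 * x 4 - x 4 * x 5 - x 5 * x 6 - x 4 * x 7"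
proof -
  have "{1..7::nat} = {1, 2, 3, 4, 5, 6, 7}" "{1..7 - 2::nat} = {1, 2, 3, 4, 5}" by auto
  then show ?thesis by (simp add: root_form_def del: One_nat_def)
qed

text \<open>The squares are completed along the three arms of the diagram towards the branch vertex.\<close>

lemma root_form_6_squares:
  "12 * root_form 6 x = 3 * (2 * x 1 - x 2)^2 + (3 * x 2 - 2 * x 3)^2 + 3 * (2 * x 5 - x 4)^2
    + (3 * x 4 - 2 * x 3)^2 + 3 * (2 * x 6 - x 3)^2 + x 3 ^ 2"
  by (simp add: root_form_6 power2_eq_square algebra_simps)

lemma root_form_7_squares:
  "24 * root_form 7 x = 6 * (2 * x 1 - x 2)^2 + 2 * (3 * x 2 - 2 * x 3)^2 + (4 * x 3 - 3 * x 4)^2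
    + 6 * (2 * x 6 - x 5)^2 + 2 * (3 * x 5 - 2 * x 4)^2 + 6 * (2 * x 7 - x 4)^2 + x 4 ^ 2"
  by (simp add: root_form_7 power2_eq_square algebra_simps)

context
  fixes n :: nat
  assumes n67: "n = 6 \<or> n = 7"
begin

lemma n_ge_6: "6 \<le> n"
  using n67 by auto

section \<open>Positive definiteness and invariance of the form\<close>

lemma root_form_nonneg: "0 \<le> root_form n x"
proof -
  have "0 \<le> 12 * root_form 6 x" unfolding root_form_6_squares by simp
  moreover have "0 \<le> 24 * root_form 7 x" unfolding root_form_7_squares by simp
  ultimately show ?thesis using n67 by auto
qed

lemma root_form_eq_0D:
  assumes "root_form n x = 0" and i: "i \<in> E_vertices n"
  shows "x i = 0"
  using n67
proof
  assume n: "n = 6"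
  then have "12 * root_form 6 x = 0" using assms by simp
  \<comment> \<open>All squares vanish; starting from the branch coordinate \<open>x 3\<close>, the
    equations kill the other coordinates along the arms.\<close>
  then have "x 3 = 0 \<and> 2 * x 6 - x 3 = 0 \<and> 3 * x 4 - 2 * x 3 = 0 \<and> 2 * x 5 - x 4 = 0
      \<and> 3 * x 2 - 2 * x 3 = 0 \<and> 2 * x 1 - x 2 = 0"
    unfolding root_form_6_squares by (simp add: add_nonneg_eq_0_iff)
  then show ?thesis using i by (auto simp: n E_vertices_6)
next
  assume n: "n = 7"
  then have "24 * root_form 7 x = 0" using assms by simp
  then have "x 4 = 0 \<and> 2 * x 7 - x 4 = 0 \<and> 3 * x 5 - 2 * x 4 = 0 \<and> 2 * x 6 - x 5 = 0
      \<and> 4 * x 3 - 3 * x 4 = 0 \<and> 3 * x 2 - 2 * x 3 = 0 \<and> 2 * x 1 - x 2 = 0"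
    unfolding root_form_7_squares by (simp add: add_nonneg_eq_0_iff)
  then show ?thesis using i by (auto simp: n E_vertices_7)
qed

lemma root_form_reflection:
  assumes s: "s \<in> E_vertices n"
  shows "root_form n (simple_reflection n s x) = root_form n x"
  using n67
proof
  assume n: "n = 6"
  show ?thesis using s unfolding n E_vertices_6
    by (auto simp: root_form_6 simple_reflection_apply neighbours_6 power2_eq_square algebra_simps
        simp del: One_nat_def)
next
  assume n: "n = 7"
  show ?thesis using s unfolding n E_vertices_7
    by (auto simp: root_form_7 simple_reflection_apply neighbours_7 power2_eq_square algebra_simps
        simp del: One_nat_def)
qed

lemma root_form_word_act:
  "w \<in> gwords (E_vertices n) \<Longrightarrow> root_form n (word_act n w x) = root_form n x"
  by (induction w) (auto simp: root_form_reflection)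

lemma root_form_simple_root:
  assumes s: "s \<in> E_vertices n"
  shows "root_form n (simple_root s) = 1"
  using n67
proof
  assume n: "n = 6"
  show ?thesis using s unfolding n E_vertices_6 by (auto simp: root_form_6 simple_root_def)
next
  assume n: "n = 7"
  show ?thesis using s unfolding n E_vertices_7 by (auto simp: root_form_7 simple_root_def)
qed

text \<open>On the sum of all simple roots the form counts vertices minus edges, which is one for a
  tree.\<close>

lemma root_form_all_ones: "root_form n (\<lambda>i. of_bool (i \<in> E_vertices n)) = 1"
  using n67
proof
  assume n: "n = 6"
  show ?thesis unfolding n root_form_6 by (simp add: E_vertices_def)
next
  assume n: "n = 7"
  show ?thesis unfolding n root_form_7 by (simp add: E_vertices_def)
qed

text \<open>If \<open>y = x + 2 z\<close>, the parallelogram law for \<open>y\<close>, \<open>x\<close> and their half sum \<open>x + z\<close> gives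
  \<open>root_form (x + z) + root_form z = 1\<close>, so one of the two vectors vanishes.\<close>

lemma roots_congruent_mod_two:
  assumes x: "root_form n x = 1" and y: "root_form n y = 1"
    and even: "\<And>i. i \<in> E_vertices n \<Longrightarrow> even (y i - x i)"
    and supp: "\<And>i. i \<notin> E_vertices n \<Longrightarrow> x i = 0 \<and> y i = 0"
  shows "y = x \<or> y = (\<lambda>i. - x i)"
proof -
  define z where "z i = (y i - x i) div 2" for i
  \<comment> \<open>Halving is exact at every index, since both vectors vanish outside the vertex
    set.\<close>
  have "even (y i - x i)" for i using even[of i] supp[of i] by (cases "i \<in> E_vertices n") auto
  then have y_eq: "y i = x i + 2 * z i" for i by (simp add: z_def)
  then have "y = (\<lambda>i. x i + 2 * z i)" by (rule ext)
  then have "root_form n (\<lambda>i. x i + z i) + root_form n z = 1"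
    using root_form_parallelogram[of n x z] x y by simp
  then consider "root_form n z = 0" | "root_form n (\<lambda>i. x i + z i) = 0"
    using root_form_nonneg[of z] root_form_nonneg[of "\<lambda>i. x i + z i"] by linarith
  then show ?thesis
  proof cases
    case 1
    then have "y i = x i" for i
      using root_form_eq_0D[of z i] y_eq[of i] supp[of i] by (cases "i \<in> E_vertices n") auto
    then show ?thesis by blast
  next
    case 2
    then have "y i = - x i" for i
      using root_form_eq_0D[of "\<lambda>i. x i + z i" i] y_eq[of i] supp[of i]
      by (cases "i \<in> E_vertices n") auto
    then show ?thesis by blast
  qed
qed

lemma simple_root_outside:
  "s \<in> E_vertices n \<Longrightarrow> i \<notin> E_vertices n \<Longrightarrow> simple_root s i = 0"
  by (auto simp: simple_root_def)

text \<open>The sum of the simple roots is a root too, which forces the signs of the single simple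
  roots to agree.\<close>

lemma acts_as_scalar_if_trivial_mod_two:
  assumes w: "w \<in> gwords (E_vertices n)"
    and even: "\<And>s i. s \<in> E_vertices n \<Longrightarrow> i \<in> E_vertices n \<Longrightarrow>
      even (word_act n w (simple_root s) i - simple_root s i)"
  shows "acts_as_scalar n w 1 \<or> acts_as_scalar n w (-1)"
proof -
  have "\<exists>c\<in>{1, -1}. word_act n w (simple_root s) = (\<lambda>i. c * simple_root s i)"
    if s: "s \<in> E_vertices n" for s
  proof -
    have "word_act n w (simple_root s) = simple_root s \<or>
        word_act n w (simple_root s) = (\<lambda>i. - simple_root s i)"
      using s w even
      by (intro roots_congruent_mod_two)
        (auto simp: root_form_word_act root_form_simple_root word_act_outside simple_root_outside)
    then show ?thesis by auto
  qed
  then obtain c where c: "\<And>s. s \<in> E_vertices n \<Longrightarrow> c s \<in> {1, -1}"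
    and act: "\<And>s. s \<in> E_vertices n \<Longrightarrow> word_act n w (simple_root s) = (\<lambda>i. c s * simple_root s i)"
    by metis
  \<comment> \<open>The sum of the simple roots. By linearity its image has the sign
    \<open>c i\<close> at each vertex i, so it is again congruent to \<open>x\<close> modulo
    two.\<close>
  define x where "x i = (of_bool (i \<in> E_vertices n) :: int)" for i
  have x: "x i = 0" if "i \<notin> E_vertices n" for i using that by (simp add: x_def)
  have fin: "finite (E_vertices n)" by (simp add: E_vertices_def)
  have wx: "word_act n w x i = c i" if i: "i \<in> E_vertices n" for i
  proof -
    have "word_act n w x i = (\<Sum>k\<in>E_vertices n. x k * word_act n w (simple_root k) i)"
      using word_act_expand[of n x w] x by simp
    also have "\<dots> = (\<Sum>k\<in>E_vertices n. if k = i then c i else 0)"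
      by (rule sum.cong) (auto simp: act x_def simple_root_apply)
    finally show ?thesis using i fin by simp
  qed
  have "word_act n w x = x \<or> word_act n w x = (\<lambda>i. - x i)"
  proof (rule roots_congruent_mod_two)
    show q: "root_form n x = 1" using root_form_all_ones by (simp add: x_def[abs_def])
    then show "root_form n (word_act n w x) = 1" using w by (simp add: root_form_word_act)
    show "even (word_act n w x i - x i)" if "i \<in> E_vertices n" for i
      using c[OF that] wx[OF that] that by (auto simp: x_def)
    show "x i = 0 \<and> word_act n w x i = 0" if "i \<notin> E_vertices n" for i
      using that w by (simp add: x word_act_outside)
  qed
  then show ?thesis
  proof
    assume "word_act n w x = x"
    then have "c s = 1" if "s \<in> E_vertices n" for s using wx[OF that] that by (simp add: x_def)
    then show ?thesis by (auto simp: acts_as_scalar_def act)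
  next
    assume "word_act n w x = (\<lambda>i. - x i)"
    then have "c s = -1" if "s \<in> E_vertices n" for s using wx[OF that] that by (simp add: x_def)
    then show ?thesis by (auto simp: acts_as_scalar_def act)
  qed
qed

section \<open>Scalar elements, the kernel and the center\<close>

lemma acts_as_scalar_supported:
  assumes "acts_as_scalar n w c" and x: "\<And>i. i \<notin> E_vertices n \<Longrightarrow> x i = 0"
  shows "word_act n w x = (\<lambda>i. c * x i)"
proof -
  have "word_act n w x i = c * x i" for i
  proof -
    have "word_act n w x i = (\<Sum>k\<in>E_vertices n. c * (x k * simple_root k i))"
      using word_act_expand[of n x w] assms(1)
      by (simp add: x acts_as_scalar_def mult.left_commute)
    also have "\<dots> = c * (\<Sum>k\<in>E_vertices n. x k * simple_root k i)"
      by (simp only: sum_distrib_left)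
    also have "\<dots> = c * x i"
      by (simp add: expand_simple_roots x)
    finally show ?thesis .
  qed
  then show ?thesis by (rule ext)
qed

text \<open>Applying the inverse to w \<alpha>_s = c \<alpha>_s gives the scalar 1/c, which is
  c.\<close>

lemma acts_as_scalar_rev:
  assumes "acts_as_scalar n w c" and "c * c = 1"
  shows "acts_as_scalar n (rev w) c"
  unfolding acts_as_scalar_def
proof
  fix s assume s: "s \<in> E_vertices n"
  have "simple_root s = word_act n (rev w) (word_act n w (simple_root s))"
    by (simp add: word_act_rev n_ge_6)
  also have "\<dots> = (\<lambda>i. c * word_act n (rev w) (simple_root s) i)"
    using assms(1) s by (simp add: acts_as_scalar_def word_act_scale)
  finally have "simple_root s i = c * word_act n (rev w) (simple_root s) i" for i
    by (rule fun_cong)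
  then show "word_act n (rev w) (simple_root s) = (\<lambda>i. c * simple_root s i)"
    using assms(2) by (simp add: mult.assoc[symmetric])
qed

lemma acts_as_sign_even:
  assumes "acts_as_scalar n w 1 \<or> acts_as_scalar n w (-1)" "s \<in> E_vertices n"
  shows "even (word_act n w (simple_root s) i - simple_root s i)"
  using assms by (auto simp: acts_as_scalar_def)

lemma vogan_kernel_iff:
  assumes \<phi>: "vogan_representation n \<phi>" and w: "w \<in> gwords (E_vertices n)"
  shows "\<phi> (pres_class (E_vertices n) (E_relators n) w) = 1\<^sub>m n \<longleftrightarrow>
    acts_as_scalar n w 1 \<or> acts_as_scalar n w (-1)"
proof -
  have "\<phi> (pres_class (E_vertices n) (E_relators n) w) = 1\<^sub>m n \<longleftrightarrow>
      acts_as_scalar n (rev w) 1 \<or> acts_as_scalar n (rev w) (-1)"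
    unfolding vogan_class_eq_one_iff[OF n_ge_6 \<phi> w]
    using acts_as_scalar_if_trivial_mod_two[OF rev_gwords[OF w]] acts_as_sign_even[of "rev w"] by blast
  also have "\<dots> \<longleftrightarrow> acts_as_scalar n w 1 \<or> acts_as_scalar n w (-1)"
    using acts_as_scalar_rev[of w 1] acts_as_scalar_rev[of w "-1"]
      acts_as_scalar_rev[of "rev w" 1] acts_as_scalar_rev[of "rev w" "-1"] by auto
  finally show ?thesis .
qed

text \<open>Commuting with s forces w \<alpha>_s into the -1 eigenspace of s, the line of
  \<alpha>_s. Conversely, scalars commute with every action, and faithfulness lifts this to
  \<open>W\<close>.\<close>

lemma center_iff:
  assumes w: "w \<in> gwords (E_vertices n)"
  shows "pres_class (E_vertices n) (E_relators n) w \<in> group_center (coxeter_group_E n) \<longleftrightarrow>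
    acts_as_scalar n w 1 \<or> acts_as_scalar n w (-1)"
    (is "?C w \<in> ?Z \<longleftrightarrow> _")
proof -
  let ?eq = "pres_eq (E_vertices n) (E_relators n)"
  have center: "?C w \<in> ?Z \<longleftrightarrow> (\<forall>v\<in>gwords (E_vertices n). ?eq (w @ v) (v @ w))"
    using w by (simp add: group_center_def coxeter_group_E_def presented_group_carrier
        presented_group_mult pres_class_eq_iff)
  show ?thesis
  proof
    assume "?C w \<in> ?Z"
    show "acts_as_scalar n w 1 \<or> acts_as_scalar n w (-1)"
    proof (rule acts_as_scalar_if_trivial_mod_two[OF w])
      fix s i assume s: "s \<in> E_vertices n" and i: "i \<in> E_vertices n"
      define y where "y = word_act n w (simple_root s)"
      have "[(s, True)] \<in> gwords (E_vertices n)" using s by simp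
      then have "?eq (w @ [(s, True)]) ([(s, True)] @ w)"
        using \<open>?C w \<in> ?Z\<close> center by blast
      from fun_cong[OF word_act_cong[OF n_ge_6 this], of "simple_root s"]
      have refl: "(\<lambda>i. - y i) = simple_reflection n s y"
        by (simp add: word_act_append reflect_simple_root_self[OF n_ge_6] word_act_neg[OF n_ge_6] y_def)
      \<comment> \<open>Off s the reflection changes no coordinate, so y_j = -y_j.\<close>
      have "y j = 0" if "j \<noteq> s" for j
        using fun_cong[OF refl, of j] that by (simp add: simple_reflection_apply)
      then have y: "y = (\<lambda>i. y s * simple_root s i)" by (auto simp: simple_root_def)
      \<comment> \<open>Invariance of the form gives y_s^2 = 1, so y_s is odd and w acts trivially
        modulo two.\<close>
      have "root_form n y = 1"
        using w s by (simp add: y_def root_form_word_act root_form_simple_root)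
      moreover have "root_form n (\<lambda>i. y s * simple_root s i) = y s * y s * root_form n (simple_root s)"
        by (simp add: root_form_def algebra_simps power_mult_distrib power2_eq_square
            sum_distrib_left)
      ultimately have "y s * y s = 1" using y s by (simp add: root_form_simple_root)
      then have "odd (y s)" by (metis even_mult_iff odd_one)
      then show "even (word_act n w (simple_root s) i - simple_root s i)"
        using fun_cong[OF y, of i] by (simp add: y_def[symmetric] simple_root_apply)
    qed
  next
    assume "acts_as_scalar n w 1 \<or> acts_as_scalar n w (-1)"
    then obtain c where c: "acts_as_scalar n w c" by blast
    have "?eq (w @ v) (v @ w)" if v: "v \<in> gwords (E_vertices n)" for v
    proof (rule W_eq_if_act_eq[OF n_ge_6])
      show "w @ v \<in> gwords (E_vertices n)" "v @ w \<in> gwords (E_vertices n)" using v w by auto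
      fix s assume s: "s \<in> E_vertices n"
      have "word_act n (w @ v) (simple_root s) = (\<lambda>i. c * word_act n v (simple_root s) i)"
        using acts_as_scalar_supported[OF c] v s
        by (simp add: word_act_append word_act_outside simple_root_outside)
      also have "\<dots> = word_act n (v @ w) (simple_root s)"
        using c s by (simp add: acts_as_scalar_def word_act_append word_act_scale)
      finally show "word_act n (w @ v) (simple_root s) = word_act n (v @ w) (simple_root s)" .
    qed
    then show "?C w \<in> ?Z" using center by blast
  qed
qed

lemma acts_as_one_imp_trivial:
  assumes "w \<in> gwords (E_vertices n)" "acts_as_scalar n w 1"
  shows "pres_eq (E_vertices n) (E_relators n) w []"
  using assms by (intro geometric_representation_faithful n_ge_6) (auto simp: acts_as_scalar_def)

end

section \<open>The element minus one\<close>

text \<open>The vector below spans the radical of the bilinear form of \<open>E\<^sub>6\<close> modulo three, so it is fixed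
  modulo three by the Weyl group.\<close>

definition E6_radical :: "nat \<Rightarrow> int" where
  "E6_radical = (\<lambda>i. if i \<in> {1, 4} then 1 else if i \<in> {2, 5} then 2 else 0)"

text \<open>Stated for every vector congruent to \<open>E6_radical\<close>, so that it iterates
  along a word. The change at s is minus the pairing with \<alpha>_s, which three divides on the
  radical.\<close>

lemma E6_radical_reflection:
  assumes "s \<in> E_vertices 6" and x: "\<And>i. 3 dvd x i - E6_radical i"
  shows "3 dvd simple_reflection 6 s x i - E6_radical i"
proof -
  have "3 dvd simple_reflection 6 s x s - E6_radical s"
    using assms(1) x[of 1] x[of 2] x[of 3] x[of 4] x[of 5] x[of 6]
    by (auto simp: simple_reflection_apply neighbours_6 E6_radical_def E_vertices_6
        simp del: One_nat_def; presburger)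
  then show ?thesis using x[of i] by (cases "i = s") (auto simp: simple_reflection_apply)
qed

lemma E6_radical_word_act:
  "w \<in> gwords (E_vertices 6) \<Longrightarrow> 3 dvd word_act 6 w E6_radical i - E6_radical i"
  by (induction w arbitrary: i) (auto simp: E6_radical_reflection)

text \<open>The scalar -1 would send the first coordinate of \<open>E6_radical\<close> from 1 to -1,
  and these differ modulo three.\<close>

lemma E6_not_minus_one:
  assumes "w \<in> gwords (E_vertices 6)"
  shows "\<not> acts_as_scalar 6 w (-1)"
proof
  assume "acts_as_scalar 6 w (-1)"
  then have "word_act 6 w E6_radical = (\<lambda>i. -1 * E6_radical i)"
    by (intro acts_as_scalar_supported) (auto simp: E6_radical_def E_vertices_6)
  then show False using E6_radical_word_act[OF assms, of 1] by (simp add: E6_radical_def)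
qed

text \<open>The ninth power of a Coxeter element of \<open>E\<^sub>7\<close>, whose Coxeter number is \<open>18\<close>.\<close>

definition E7_longest :: "nat gword" where
  "E7_longest = word_power [1, 2, 3, 4, 5, 6, 7] 9"

text \<open>Symbolic vectors with seven named coordinates, on which reflections are computed by
  rewriting.\<close>

definition vec7 :: "int \<Rightarrow> int \<Rightarrow> int \<Rightarrow> int \<Rightarrow> int \<Rightarrow> int \<Rightarrow> int \<Rightarrow> nat \<Rightarrow> int" where
  "vec7 a b c d e f g = (\<lambda>i. if i = 1 then a else if i = 2 then b else if i = 3 then c
    else if i = 4 then d else if i = 5 then e else if i = 6 then f else if i = 7 then g else 0)"

lemma reflection_vec7:
  "simple_reflection 7 1 (vec7 a b c d e f g) = vec7 (b - a) b c d e f g"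
  "simple_reflection 7 2 (vec7 a b c d e f g) = vec7 a (a + c - b) c d e f g"
  "simple_reflection 7 3 (vec7 a b c d e f g) = vec7 a b (b + d - c) d e f g"
  "simple_reflection 7 4 (vec7 a b c d e f g) = vec7 a b c (c + e + g - d) e f g"
  "simple_reflection 7 5 (vec7 a b c d e f g) = vec7 a b c d (d + f - e) f g"
  "simple_reflection 7 6 (vec7 a b c d e f g) = vec7 a b c d e (e - f) g"
  "simple_reflection 7 7 (vec7 a b c d e f g) = vec7 a b c d e f (d - g)"
  by (auto simp: fun_eq_iff simple_reflection_apply neighbours_7 vec7_def simp del: One_nat_def)

lemma vec7_cong:
  "a = a' \<Longrightarrow> b = b' \<Longrightarrow> c = c' \<Longrightarrow> d = d' \<Longrightarrow> e = e' \<Longrightarrow> f = f' \<Longrightarrow> g = g' \<Longrightarrow>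
    vec7 a b c d e f g = vec7 a' b' c' d' e' f' g'"
  by simp

lemma coxeter_element_vec7:
  "word_act 7 (map (\<lambda>s. (s, True)) [1, 2, 3, 4, 5, 6, 7]) (vec7 a b c d e f g) =
    vec7 (d - f - g) (a + d - f - g) (b + d - f - g) (c + d - f - g) (d - f) (e - f) (d - g)"
  by (simp add: reflection_vec7 algebra_simps del: One_nat_def)

text \<open>A closed form for the cube of the Coxeter element; cubing it again reaches the ninth
  power while the expressions stay short.\<close>

lemma coxeter_element_cube_vec7:
  defines "c3 \<equiv> word_act 7 (word_power [1, 2, 3, 4, 5, 6, 7] 3)"
  shows "c3 (vec7 a b c d e f g) = vec7
    (b - g)
    (b + c - e - g) (b + c + d - e - f - 2 * g) (a + b + c + d - e - f - 2 * g) (b + c - f - g) (c - g) (b + d - e - g)"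
proof -
  have "word_power ss 3 = map (\<lambda>s. (s, True)) ss @ map (\<lambda>s. (s, True)) ss @ map (\<lambda>s. (s, True)) ss"
    for ss :: "nat list"
    by (simp add: word_power_def numeral_3_eq_3)
  then show ?thesis
    by (simp only: c3_def word_act_append coxeter_element_vec7) (rule vec7_cong; simp)
qed

lemma E7_longest_minus_one: "acts_as_scalar 7 E7_longest (-1)"
  unfolding acts_as_scalar_def
proof
  fix s assume s: "s \<in> E_vertices 7"
  let ?c = "word_power [1, 2, 3, 4, 5, 6, 7] 3"
  have longest: "E7_longest = ?c @ ?c @ ?c"
    by (simp add: E7_longest_def word_power_def numeral_eq_Suc)
  have neg: "word_act 7 E7_longest (vec7 a b c d e f g) =
      vec7 (- a) (- b) (- c) (- d) (- e) (- f) (- g)" for a b c d e f g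
    by (simp only: longest word_act_append coxeter_element_cube_vec7) (rule vec7_cong; simp)
  have root: "simple_root s = vec7 (simple_root s 1) (simple_root s 2) (simple_root s 3)
      (simple_root s 4) (simple_root s 5) (simple_root s 6) (simple_root s 7)"
    using s by (auto simp: fun_eq_iff vec7_def simple_root_def E_vertices_7)
  show "word_act 7 E7_longest (simple_root s) = (\<lambda>i. -1 * simple_root s i)"
    by (subst (1 2) root, subst neg) (simp add: vec7_def fun_eq_iff)
qed

section \<open>The kernel of the Vogan representation and the center of \<open>W\<close>\<close>

theorem proposition7p8:
  fixes n :: nat and \<phi> :: "nat gword set \<Rightarrow> bit mat"
  assumes "n = 6 \<or> n = 7"
    and "vogan_representation n \<phi>"
  shows "(n = 6 \<longrightarrow> inj_on \<phi> (carrier (coxeter_group_E n)))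
    \<and> (n = 7 \<longrightarrow> card (kernel (coxeter_group_E n) (GL_F2 n) \<phi>) = 2)
    \<and> kernel (coxeter_group_E n) (GL_F2 n) \<phi> = group_center (coxeter_group_E n)"
proof -
  note n = assms(1) and n6 = n_ge_6[OF assms(1)]
  let ?V = "E_vertices n" and ?R = "E_relators n"
  let ?K = "kernel (coxeter_group_E n) (GL_F2 n) \<phi>"
  have carrier: "carrier (coxeter_group_E n) = pres_class ?V ?R ` gwords ?V"
    by (simp add: coxeter_group_E_def presented_group_carrier)
  have K: "?K = {x. \<exists>w\<in>gwords ?V. x = pres_class ?V ?R w
      \<and> (acts_as_scalar n w 1 \<or> acts_as_scalar n w (-1))}"
    using vogan_kernel_iff[OF n assms(2)] by (auto simp: kernel_def carrier GL_F2_simps)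
  \<comment> \<open>Central elements lie in the carrier, so each is the class of a word and
    \<open>center_iff\<close> applies.\<close>
  have "group_center (coxeter_group_E n) \<subseteq> carrier (coxeter_group_E n)"
    by (auto simp: group_center_def)
  then have K_center: "?K = group_center (coxeter_group_E n)"
    unfolding K using center_iff[OF n] by (auto simp: carrier)
  interpret vogan: group_hom "coxeter_group_E n" "GL_F2 n" \<phi>
    using assms(2) group_GL_F2 group_presented_group
    by (auto simp: group_hom_def group_hom_axioms_def vogan_representation_def coxeter_group_E_def)
  have trivial: "pres_class ?V ?R w = pres_class ?V ?R []"
    if "w \<in> gwords ?V" "acts_as_scalar n w 1" for w
    using acts_as_one_imp_trivial[OF n that] that by (simp add: pres_class_eq_iff)
  have "inj_on \<phi> (carrier (coxeter_group_E n))" if 6: "n = 6"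
  proof (rule vogan.trivial_ker_imp_inj)
    have "?K \<subseteq> {\<one>\<^bsub>coxeter_group_E n\<^esub>}"
    proof
      fix x assume "x \<in> ?K"
      then obtain w where w: "w \<in> gwords ?V" "x = pres_class ?V ?R w"
        "acts_as_scalar n w 1 \<or> acts_as_scalar n w (-1)"
        unfolding K by blast
      \<comment> \<open>The radical modulo three excludes -1; a word acting as 1 is trivial by
        faithfulness.\<close>
      then have "acts_as_scalar n w 1" using E6_not_minus_one[of w] by (auto simp: 6)
      then have "x = pres_class ?V ?R []" using trivial[OF w(1)] w(2) by simp
      then show "x \<in> {\<one>\<^bsub>coxeter_group_E n\<^esub>}"
        by (simp add: coxeter_group_E_def presented_group_one)
    qed
    then show "?K = {\<one>\<^bsub>coxeter_group_E n\<^esub>}"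
      using vogan.hom_one by (auto simp: kernel_def)
  qed
  moreover have "card ?K = 2" if 7: "n = 7"
  proof -
    let ?z = "pres_class ?V ?R E7_longest" and ?one = "pres_class ?V ?R []"
    have z: "E7_longest \<in> gwords ?V"
      by (simp add: E7_longest_def word_power_def numeral_eq_Suc 7 E_vertices_def)
    have minus: "acts_as_scalar n E7_longest (-1)" using E7_longest_minus_one by (simp add: 7)
    \<comment> \<open>Faithfulness makes the element acting as -1 unique, so the kernel has at most
      two elements.\<close>
    have "pres_class ?V ?R w = ?z" if w: "w \<in> gwords ?V" "acts_as_scalar n w (-1)" for w
      using w minus z W_eq_if_act_eq[OF n6 w(1) z]
      by (simp add: pres_class_eq_iff acts_as_scalar_def)
    then have "?K \<subseteq> {?one, ?z}" using trivial by (auto simp: K)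
    moreover have "?one \<in> ?K"
    proof -
      have "[] \<in> gwords ?V" "acts_as_scalar n [] 1" by (simp_all add: acts_as_scalar_def)
      then show ?thesis unfolding K by blast
    qed
    moreover have "?z \<in> ?K" unfolding K using z minus by blast
    ultimately have "?K = {?one, ?z}" by auto
    moreover have "?one \<noteq> ?z"
    proof
      assume "?one = ?z"
      \<comment> \<open>Over the integers 1 and -1 differ on \<alpha>_1, although they agree modulo
        two.\<close>
      then have "word_act n E7_longest = word_act n []"
        using z word_act_cong[OF n6] by (simp add: pres_class_eq_iff)
      moreover have "1 \<in> ?V" by (simp add: 7 E_vertices_def)
      ultimately show False
        using minus by (auto simp: acts_as_scalar_def simple_root_def fun_eq_iff)
    qed
    ultimately show ?thesis by simp
  qed
  ultimately show ?thesis using K_center by blast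
qed

end
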